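(* Let $K$ be a noetherian commutative ring with unity and let $c\ge 1$ be an integer. Let $\mathbf{P}$ be the algebra with $\mathbf{P}_S=K[x_{i,j} : i\in[c],\ j\in S]$ and $\varepsilon^*(x_{i,j})=x_{i,\varepsilon(j)}$ for a morphism $\varepsilon\colon S\to T$; considered as an $\mathrm{OI}$-algebra it is $(\mathbf{X}^{\mathrm{OI},1})^{\otimes c}$, and considered as an $\mathrm{FI}$-algebra it is $(\mathbf{X}^{\mathrm{FI},1})^{\otimes c}$. Then: (i) Every finitely generated $\mathrm{OI}$-module over $(\mathbf{X}^{\mathrm{OI},1})^{\otimes c}$ is noetherian. (ii) Every finitely generated $\mathrm{FI}$-module over $(\mathbf{X}^{\mathrm{FI},1})^{\otimes c}$ is noetherian.
   Context: $[n]=\{1,\dots,n\}$, $[0]=\emptyset$. $\mathrm{FI}$ is the category of finite sets and injective maps; $\mathrm{OI}$ is the category of totally ordered finite sets and order-preserving injective maps. An $\mathrm{OI}$-algebra (resp. $\mathrm{FI}$-algebra) over $K$ is a covariant functor $\mathbf{A}$ from $\mathrm{OI}$ (resp. $\mathrm{FI}$) to commutative associative unital $K$-algebras with $\mathbf{A}(\emptyset)=K$; write $\mathbf{A}_S=\mathbf{A}(S)$, $\mathbf{A}_n=\mathbf{A}([n])$, $\varepsilon^*=\mathbf{A}(\varepsilon)$. An $\mathrm{OI}$-module (resp. $\mathrm{FI}$-module) over $\mathbf{A}$ is a covariant functor $\mathbf{M}$ from $\mathrm{OI}$ (resp. $\mathrm{FI}$) to $K$-modules such that each $\mathbf{M}_S=\mathbf{M}(S)$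 is also an $\mathbf{A}_S$-module and, for all morphisms $\tilde\varepsilon\colon\tilde S\to S$, $\varepsilon\colon S\to T$ and all $a\in\mathbf{A}_{\tilde S}$, $q\in\mathbf{M}_S$, one has $\mathbf{M}(\varepsilon)(\mathbf{A}(\tilde\varepsilon)(a)\cdot q)=\mathbf{A}(\varepsilon\circ\tilde\varepsilon)(a)\cdot\mathbf{M}(\varepsilon)(q)$. A submodule $\mathbf{N}$ of $\mathbf{M}$ is a family of $\mathbf{A}_S$-submodules $\mathbf{N}_S\subseteq\mathbf{M}_S$ stable under all maps $\mathbf{M}(\varepsilon)$. $\mathbf{M}$ is finitely generated if there is a finite subset of $\coprod_{n\ge0}\mathbf{M}_n$ not contained in any proper submodule of $\mathbf{M}$. $\mathbf{M}$ is noetherian if every submodule of $\mathbf{M}$ is finitely generated. *)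

theory Defs
  imports "HOL-Library.FuncSet" "HOL-Library.Multiset" "HOL-Library.Poly_Mapping" 
    "HOL-Algebra.Module" "HOL-Algebra.Ring_Divisibility"
begin

text \<open>
  A category of finite sets (possibly with extra structure) and maps.  \<open>Pt C S\<close> is the underlying
  set of the object \<open>S\<close>, and \<open>Std C n\<close> is the object $[n]$.  A morphism is a function that is
  extensional (\<open>undefined\<close> outside its source), so that equality of morphisms is equality of
  functions; composition is \<^const>\<open>compose\<close>.
\<close>

record ('o, 'u) set_cat =
  Ob :: "'o set"
  Pt :: "'o \<Rightarrow> 'u set"
  Mor :: "'o \<Rightarrow> 'o \<Rightarrow> ('u \<Rightarrow> 'u) set"
  Std :: "nat \<Rightarrow> 'o"

text \<open>
  HOL has no set of all finite sets, so the finite sets range over the finite subsets of an arbitrary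
  infinite universe \<open>'u\<close>.  An injection \<open>\<iota>\<close> from the natural numbers to \<open>'u\<close> says which elements of
  the universe play the role of $1, 2, 3, \dots$, so that $[n]$ is \<open>\<iota> ` {1..n}\<close> with its usual order.
  An object of $\mathrm{OI}$ is a finite set together with any total order on it.
\<close>

definition FI :: "(nat \<Rightarrow> 'u) \<Rightarrow> ('u set, 'u) set_cat" where
  "FI \<iota> =
    \<lparr>Ob = {S. finite S},
     Pt = (\<lambda>S. S),
     Mor = (\<lambda>S T. {\<epsilon> \<in> S \<rightarrow>\<^sub>E T. inj_on \<epsilon> S}),
     Std = (\<lambda>n. \<iota> ` {1..n})\<rparr>"

definition OI :: "(nat \<Rightarrow> 'u) \<Rightarrow> ('u set \<times> 'u rel, 'u) set_cat" where
  "OI \<iota> =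
    \<lparr>Ob = {(S, r). finite S \<and> linear_order_on S r},
     Pt = fst,
     Mor = (\<lambda>(S, r) (T, s). {\<epsilon> \<in> S \<rightarrow>\<^sub>E T. inj_on \<epsilon> S \<and>
              (\<forall>x\<in>S. \<forall>y\<in>S. (x, y) \<in> r \<longrightarrow> (\<epsilon> x, \<epsilon> y) \<in> s)}),
     Std = (\<lambda>n. (\<iota> ` {1..n}, {(\<iota> i, \<iota> j) | i j. 1 \<le> i \<and> i \<le> j \<and> j \<le> n}))\<rparr>"


text \<open>
  \<open>C\<close>-algebras over \<open>K\<close>.  The structure map $K \to \mathbf{A}_S$ is \<open>scal A S\<close>, and
  $\mathbf{A}(\emptyset) = K$ means that it is bijective on empty \<open>S\<close>.
\<close>

record ('k, 'o, 'u, 'a) cat_alg =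
  ring_at :: "'o \<Rightarrow> 'a ring"
  scal :: "'o \<Rightarrow> 'k \<Rightarrow> 'a"
  alg_map :: "'o \<Rightarrow> 'o \<Rightarrow> ('u \<Rightarrow> 'u) \<Rightarrow> 'a \<Rightarrow> 'a"

locale cat_algebra =
  fixes K :: "'k ring" and C :: "('o, 'u) set_cat" and A :: "('k, 'o, 'u, 'a) cat_alg"
  assumes K_cring: "cring K"
    and ring_at_cring: "S \<in> Ob C \<Longrightarrow> cring (ring_at A S)"
    and scal_hom: "S \<in> Ob C \<Longrightarrow> scal A S \<in> ring_hom K (ring_at A S)"
    and scal_empty: "\<lbrakk>S \<in> Ob C; Pt C S = {}\<rbrakk> \<Longrightarrow>
          bij_betw (scal A S) (carrier K) (carrier (ring_at A S))"
    and alg_map_hom: "\<lbrakk>S \<in> Ob C; T \<in> Ob C; \<epsilon> \<in> Mor C S T\<rbrakk> \<Longrightarrow>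
          alg_map A S T \<epsilon> \<in> ring_hom (ring_at A S) (ring_at A T)"
    and alg_map_scal: "\<lbrakk>S \<in> Ob C; T \<in> Ob C; \<epsilon> \<in> Mor C S T; k \<in> carrier K\<rbrakk> \<Longrightarrow>
          alg_map A S T \<epsilon> (scal A S k) = scal A T k"
    and alg_map_id: "\<lbrakk>S \<in> Ob C; a \<in> carrier (ring_at A S)\<rbrakk> \<Longrightarrow>
          alg_map A S S (\<lambda>x\<in>Pt C S. x) a = a"
    and alg_map_comp: "\<lbrakk>R \<in> Ob C; S \<in> Ob C; T \<in> Ob C; \<delta> \<in> Mor C R S; \<epsilon> \<in> Mor C S T;
          a \<in> carrier (ring_at A R)\<rbrakk> \<Longrightarrow>
          alg_map A R T (compose (Pt C R) \<epsilon> \<delta>) a = alg_map A S T \<epsilon> (alg_map A R S \<delta> a)"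


text \<open>
  \<open>C\<close>-modules over \<open>A\<close>.  The \<open>K\<close>-module structure of $\mathbf{M}_S$ is the one obtained from its
  $\mathbf{A}_S$-module structure along $K \to \mathbf{A}_S$.
\<close>

record ('o, 'u, 'a, 'm) cat_mod =
  mod_at :: "'o \<Rightarrow> ('a, 'm) module"
  mod_map :: "'o \<Rightarrow> 'o \<Rightarrow> ('u \<Rightarrow> 'u) \<Rightarrow> 'm \<Rightarrow> 'm"

locale cat_module = cat_algebra K C A
  for K :: "'k ring" and C :: "('o, 'u) set_cat" and A :: "('k, 'o, 'u, 'a) cat_alg" +
  fixes M :: "('o, 'u, 'a, 'm) cat_mod"
  assumes mod_at_module: "S \<in> Ob C \<Longrightarrow> module (ring_at A S) (mod_at M S)"
    and mod_map_closed: "\<lbrakk>S \<in> Ob C; T \<in> Ob C; \<epsilon> \<in> Mor C S T; q \<in> carrier (mod_at M S)\<rbrakk> \<Longrightarrow>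
          mod_map M S T \<epsilon> q \<in> carrier (mod_at M T)"
    and mod_map_add: "\<lbrakk>S \<in> Ob C; T \<in> Ob C; \<epsilon> \<in> Mor C S T;
          p \<in> carrier (mod_at M S); q \<in> carrier (mod_at M S)\<rbrakk> \<Longrightarrow>
          mod_map M S T \<epsilon> (p \<oplus>\<^bsub>mod_at M S\<^esub> q) = mod_map M S T \<epsilon> p \<oplus>\<^bsub>mod_at M T\<^esub> mod_map M S T \<epsilon> q"
    and mod_map_scal: "\<lbrakk>S \<in> Ob C; T \<in> Ob C; \<epsilon> \<in> Mor C S T;
          k \<in> carrier K; q \<in> carrier (mod_at M S)\<rbrakk> \<Longrightarrow>
          mod_map M S T \<epsilon> (scal A S k \<odot>\<^bsub>mod_at M S\<^esub> q) = scal A T k \<odot>\<^bsub>mod_at M T\<^esub> mod_map M S T \<epsilon> q"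
    and mod_map_id: "\<lbrakk>S \<in> Ob C; q \<in> carrier (mod_at M S)\<rbrakk> \<Longrightarrow>
          mod_map M S S (\<lambda>x\<in>Pt C S. x) q = q"
    and mod_map_comp: "\<lbrakk>R \<in> Ob C; S \<in> Ob C; T \<in> Ob C; \<delta> \<in> Mor C R S; \<epsilon> \<in> Mor C S T;
          q \<in> carrier (mod_at M R)\<rbrakk> \<Longrightarrow>
          mod_map M R T (compose (Pt C R) \<epsilon> \<delta>) q = mod_map M S T \<epsilon> (mod_map M R S \<delta> q)"
    and mod_map_smult: "\<lbrakk>R \<in> Ob C; S \<in> Ob C; T \<in> Ob C; \<delta> \<in> Mor C R S; \<epsilon> \<in> Mor C S T;
          a \<in> carrier (ring_at A R); q \<in> carrier (mod_at M S)\<rbrakk> \<Longrightarrow>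
          mod_map M S T \<epsilon> (alg_map A R S \<delta> a \<odot>\<^bsub>mod_at M S\<^esub> q) =
            alg_map A R T (compose (Pt C R) \<epsilon> \<delta>) a \<odot>\<^bsub>mod_at M T\<^esub> mod_map M S T \<epsilon> q"

definition cat_submodule ::
  "('o, 'u) set_cat \<Rightarrow> ('k, 'o, 'u, 'a) cat_alg \<Rightarrow> ('o, 'u, 'a, 'm) cat_mod \<Rightarrow> ('o \<Rightarrow> 'm set) \<Rightarrow> bool"
  where "cat_submodule C A M N \<longleftrightarrow>
    (\<forall>S\<in>Ob C. submodule (N S) (ring_at A S) (mod_at M S)) \<and>
    (\<forall>S\<in>Ob C. \<forall>T\<in>Ob C. \<forall>\<epsilon>\<in>Mor C S T. mod_map M S T \<epsilon> ` N S \<subseteq> N T)"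

definition proper_submodule ::
  "('o, 'u) set_cat \<Rightarrow> ('k, 'o, 'u, 'a) cat_alg \<Rightarrow> ('o, 'u, 'a, 'm) cat_mod \<Rightarrow> ('o \<Rightarrow> 'm set) \<Rightarrow> bool"
  where "proper_submodule C A M N \<longleftrightarrow>
    cat_submodule C A M N \<and> (\<exists>S\<in>Ob C. N S \<noteq> carrier (mod_at M S))"

definition finitely_generated ::
  "('o, 'u) set_cat \<Rightarrow> ('k, 'o, 'u, 'a) cat_alg \<Rightarrow> ('o, 'u, 'a, 'm) cat_mod \<Rightarrow> bool"
  where "finitely_generated C A M \<longleftrightarrow>
    (\<exists>G. finite G \<and> G \<subseteq> (SIGMA n:UNIV. carrier (mod_at M (Std C n))) \<and>
       \<not> (\<exists>N. proper_submodule C A M N \<and> G \<subseteq> (SIGMA n:UNIV. N (Std C n))))"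

definition as_module :: "('o, 'u, 'a, 'm) cat_mod \<Rightarrow> ('o \<Rightarrow> 'm set) \<Rightarrow> ('o, 'u, 'a, 'm) cat_mod"
  where "as_module M N = M\<lparr>mod_at := (\<lambda>S. (mod_at M S)\<lparr>carrier := N S\<rparr>)\<rparr>"

definition noetherian_module ::
  "('o, 'u) set_cat \<Rightarrow> ('k, 'o, 'u, 'a) cat_alg \<Rightarrow> ('o, 'u, 'a, 'm) cat_mod \<Rightarrow> bool"
  where "noetherian_module C A M \<longleftrightarrow>
    (\<forall>N. cat_submodule C A M N \<longrightarrow> finitely_generated C A (as_module M N))"


text \<open>
  Polynomials: a monomial is the multiset of its variables, and a polynomial is a finitely supported
  function from monomials to coefficients.  The coefficient sort is \<open>{comm_ring, monoid_mult}\<close>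
  because \<^class>\<open>comm_ring_1\<close> would exclude the zero ring; for the same reason the polynomial
  \<open>1\<close> is written as \<open>Poly_Mapping.single {#} 1\<close>.
\<close>

definition type_ring :: "'k::{comm_ring,monoid_mult} ring" where
  "type_ring = \<lparr>carrier = UNIV, mult = (*), one = 1, zero = 0, add = (+)\<rparr>"

definition poly_ring :: "'v set \<Rightarrow> ('v multiset \<Rightarrow>\<^sub>0 'k::{comm_ring,monoid_mult}) ring" where
  "poly_ring V =
    \<lparr>carrier = {p. \<forall>m\<in>Poly_Mapping.keys p. set_mset m \<subseteq> V},
     mult = (*), one = Poly_Mapping.single {#} 1, zero = 0, add = (+)\<rparr>"

text \<open>The algebra map that sends the variable \<open>v\<close> to the variable \<open>f v\<close>.\<close>

definition rename_vars :: "('v \<Rightarrow> 'w) \<Rightarrow> ('v multiset \<Rightarrow>\<^sub>0 'k) \<Rightarrow> ('w multiset \<Rightarrow>\<^sub>0 'k::{comm_ring,monoid_mult})"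
  where "rename_vars f p =
    (\<Sum>m\<in>Poly_Mapping.keys p. Poly_Mapping.single (image_mset f m) (Poly_Mapping.lookup p m))"

text \<open>
  The algebra $\mathbf{P} = (\mathbf{X}^{C,1})^{\otimes c}$ for \<open>C\<close> equal to \<^const>\<open>OI\<close> or
  \<^const>\<open>FI\<close>; the pair \<open>(i, j)\<close> stands for the variable $x_{i,j}$.
\<close>

definition X1_power ::
  "('o, 'u) set_cat \<Rightarrow> nat \<Rightarrow> ('k::{comm_ring,monoid_mult}, 'o, 'u, (nat \<times> 'u) multiset \<Rightarrow>\<^sub>0 'k) cat_alg"
  where "X1_power C c =
    \<lparr>ring_at = (\<lambda>S. poly_ring ({1..c} \<times> Pt C S)),
     scal = (\<lambda>S k. Poly_Mapping.single {#} k),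
     alg_map = (\<lambda>S T \<epsilon>. rename_vars (\<lambda>(i, j). (i, \<epsilon> j)))\<rparr>"


lemma type_ring_cring: "cring (type_ring :: 'k::{comm_ring,monoid_mult} ring)"
proof -
  have "\<exists>y. y + x = 0 \<and> x + y = 0" for x :: 'k
    by (rule exI[of _ "- x"]) simp
  then show ?thesis
    by unfold_locales (auto simp: type_ring_def algebra_simps Units_def)
qed

lemma single_one_mult [simp]:
  fixes p :: "'v multiset \<Rightarrow>\<^sub>0 'k::{comm_ring,monoid_mult}"
  shows "Poly_Mapping.single {#} 1 * p = p"
proof -
  have "Poly_Mapping.map ((*) (1::'k)) p = p"
    by (rule poly_mapping_eqI) (simp add: Poly_Mapping.map.rep_eq when_def)
  then show ?thesis
    by (simp add: mult_map_scale_conv_mult)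
qed

lemma poly_ring_cring: "cring (poly_ring V :: ('v multiset \<Rightarrow>\<^sub>0 'k::{comm_ring,monoid_mult}) ring)"
  (is "cring ?R")
proof -
  have add: "\<forall>m\<in>Poly_Mapping.keys (p + q). set_mset m \<subseteq> V"
    if "\<forall>m\<in>Poly_Mapping.keys p. set_mset m \<subseteq> V" "\<forall>m\<in>Poly_Mapping.keys q. set_mset m \<subseteq> V"
    for p q :: "'v multiset \<Rightarrow>\<^sub>0 'k"
    using that Poly_Mapping.keys_add[of p q] by blast
  have mult: "\<forall>m\<in>Poly_Mapping.keys (p * q). set_mset m \<subseteq> V"
    if "\<forall>m\<in>Poly_Mapping.keys p. set_mset m \<subseteq> V" "\<forall>m\<in>Poly_Mapping.keys q. set_mset m \<subseteq> V"
    for p q :: "'v multiset \<Rightarrow>\<^sub>0 'k"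
    using that keys_mult[of p q] by fastforce
  have neg: "\<exists>q. (\<forall>m\<in>Poly_Mapping.keys q. set_mset m \<subseteq> V) \<and> q + p = 0"
    if "\<forall>m\<in>Poly_Mapping.keys p. set_mset m \<subseteq> V" for p :: "'v multiset \<Rightarrow>\<^sub>0 'k"
    using that by (intro exI[of _ "- p"]) (auto simp: in_keys_iff)
  note defs = poly_ring_def partial_object.simps monoid.simps ring.simps mem_Collect_eq
  show ?thesis
  proof (rule cringI)
    show "abelian_group ?R"
    proof (rule abelian_groupI)
      show "p \<oplus>\<^bsub>?R\<^esub> q \<in> carrier ?R" if "p \<in> carrier ?R" "q \<in> carrier ?R" for p q
        using that unfolding defs by (rule add)
      show "\<exists>q\<in>carrier ?R. q \<oplus>\<^bsub>?R\<^esub> p = \<zero>\<^bsub>?R\<^esub>" if "p \<in> carrier ?R" for p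
        using neg[of p] that unfolding defs by blast
    qed (simp_all add: poly_ring_def add_ac)
    show "comm_monoid ?R"
    proof (rule comm_monoidI)
      show "p \<otimes>\<^bsub>?R\<^esub> q \<in> carrier ?R" if "p \<in> carrier ?R" "q \<in> carrier ?R" for p q
        using that unfolding defs by (rule mult)
    qed (simp_all add: poly_ring_def mult.assoc, rule mult.commute)
  qed (simp add: poly_ring_def distrib_right)
qed

lemma rename_vars_superset:
  assumes "finite X" "Poly_Mapping.keys p \<subseteq> X"
  shows "rename_vars f p =
    (\<Sum>m\<in>X. Poly_Mapping.single (image_mset f m) (Poly_Mapping.lookup p m))"
  unfolding rename_vars_def
  by (rule sum.mono_neutral_left) (use assms in \<open>auto simp: in_keys_iff\<close>)

lemma rename_vars_add: "rename_vars f (p + q) = rename_vars f p + rename_vars f q"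
proof -
  let ?X = "Poly_Mapping.keys p \<union> Poly_Mapping.keys q"
  have "rename_vars f r =
      (\<Sum>m\<in>?X. Poly_Mapping.single (image_mset f m) (Poly_Mapping.lookup r m))"
    if "r = p \<or> r = q \<or> r = p + q" for r
    using that Poly_Mapping.keys_add[of p q] by (intro rename_vars_superset) auto
  then show ?thesis
    by (simp add: lookup_add single_add sum.distrib)
qed

lemma rename_vars_single [simp]:
  "rename_vars f (Poly_Mapping.single m k) = Poly_Mapping.single (image_mset f m) k"
  by (subst rename_vars_superset[of "{m}"]) auto

lemma rename_vars_zero [simp]: "rename_vars f 0 = 0"
  by (simp add: rename_vars_def)

lemma rename_vars_sum: "rename_vars f (sum g X) = (\<Sum>x\<in>X. rename_vars f (g x))"
  by (induction X rule: infinite_finite_induct) (auto simp: rename_vars_add)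

lemma poly_mapping_expand:
  "p = (\<Sum>m\<in>Poly_Mapping.keys p. Poly_Mapping.single m (Poly_Mapping.lookup p m))"
  by (rule poly_mapping_eqI)
    (auto simp: lookup_sum lookup_single when_def in_keys_iff sum.delta)

lemma rename_vars_mult: "rename_vars f (p * q) = rename_vars f p * rename_vars f q"
proof -
  have "p * q = (\<Sum>m\<in>Poly_Mapping.keys p. \<Sum>n\<in>Poly_Mapping.keys q.
      Poly_Mapping.single (m + n) (Poly_Mapping.lookup p m * Poly_Mapping.lookup q n))"
    using arg_cong2[OF poly_mapping_expand[of p] poly_mapping_expand[of q], of "(*)"]
    by (simp add: sum_product mult_single)
  moreover have "rename_vars f p * rename_vars f q =
      (\<Sum>m\<in>Poly_Mapping.keys p. \<Sum>n\<in>Poly_Mapping.keys q. Poly_Mapping.single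
        (image_mset f (m + n)) (Poly_Mapping.lookup p m * Poly_Mapping.lookup q n))"
    by (simp add: rename_vars_def sum_product mult_single)
  ultimately show ?thesis
    by (simp add: rename_vars_sum)
qed

lemma rename_vars_cong:
  assumes "\<And>m v. m \<in> Poly_Mapping.keys p \<Longrightarrow> v \<in> set_mset m \<Longrightarrow> f v = g v"
  shows "rename_vars f p = rename_vars g p"
  unfolding rename_vars_def
  by (intro sum.cong refl arg_cong2[of _ _ _ _ Poly_Mapping.single] image_mset_cong) (use assms in auto)

lemma rename_vars_id: "rename_vars (\<lambda>v. v) p = p"
  using poly_mapping_expand[of p] by (simp add: rename_vars_def)

lemma rename_vars_comp: "rename_vars f (rename_vars g p) = rename_vars (f \<circ> g) p"
  by (simp add: rename_vars_def[of g] rename_vars_def[of "f \<circ> g"] rename_vars_sum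
      multiset.map_comp)

lemma keys_rename_vars: "Poly_Mapping.keys (rename_vars f p) \<subseteq> image_mset f ` Poly_Mapping.keys p"
  unfolding rename_vars_def by (rule order_trans[OF keys_sum]) auto

lemma X1_power_algebra:
  fixes C :: "('o, 'u) set_cat"
  assumes ext: "\<And>S T \<epsilon>. \<lbrakk>S \<in> Ob C; T \<in> Ob C; \<epsilon> \<in> Mor C S T\<rbrakk> \<Longrightarrow> \<epsilon> \<in> Pt C S \<rightarrow>\<^sub>E Pt C T"
  shows "cat_algebra (type_ring :: 'k::{comm_ring,monoid_mult} ring) C (X1_power C c)"
proof -
  let ?P = "X1_power C c :: ('k, 'o, 'u, (nat \<times> 'u) multiset \<Rightarrow>\<^sub>0 'k) cat_alg"
  show ?thesis
  proof (rule cat_algebra.intro)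
    show "cring (type_ring :: 'k ring)"
      by (rule type_ring_cring)
    show "cring (ring_at ?P S)" for S
      by (simp add: X1_power_def poly_ring_cring)
    show "scal ?P S \<in> ring_hom (type_ring :: 'k ring) (ring_at ?P S)" for S
      by (rule ring_hom_memI)
        (auto simp: X1_power_def poly_ring_def type_ring_def single_add mult_single)
    show "bij_betw (scal ?P S) (carrier (type_ring :: 'k ring)) (carrier (ring_at ?P S))"
      if "S \<in> Ob C" "Pt C S = {}" for S
    proof -
      have "p \<in> Set.range (Poly_Mapping.single {#})"
        if "\<forall>m\<in>Poly_Mapping.keys p. m = {#}" for p :: "(nat \<times> 'u) multiset \<Rightarrow>\<^sub>0 'k"
      proof
        show "p = Poly_Mapping.single {#} (Poly_Mapping.lookup p {#})"
          using that by (intro poly_mapping_eqI) (auto simp: lookup_single when_def in_keys_iff)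
      qed simp
      then show ?thesis
        using that
        by (auto simp: X1_power_def poly_ring_def type_ring_def bij_betw_def inj_on_def
            dest: arg_cong[where f = "\<lambda>p. Poly_Mapping.lookup p {#}"] split: if_splits)
    qed
    show "alg_map ?P S T \<epsilon> \<in> ring_hom (ring_at ?P S)
            (ring_at ?P T)"
      if \<epsilon>: "S \<in> Ob C" "T \<in> Ob C" "\<epsilon> \<in> Mor C S T" for S T \<epsilon>
    proof (rule ring_hom_memI)
      let ?f = "\<lambda>(i :: nat, j). (i, \<epsilon> j)"
      fix p assume p: "p \<in> carrier (ring_at ?P S)"
      have "set_mset m \<subseteq> {1..c} \<times> Pt C T" if m: "m \<in> Poly_Mapping.keys (rename_vars ?f p)" for m
      proof -
        obtain m' where m': "m' \<in> Poly_Mapping.keys p" "m = image_mset ?f m'"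
          using m keys_rename_vars[of ?f p] by blast
        have "set_mset m' \<subseteq> {1..c} \<times> Pt C S"
          using p m' by (auto simp: X1_power_def poly_ring_def)
        then show ?thesis
          using ext[OF \<epsilon>] m' by fastforce
      qed
      then show "alg_map ?P S T \<epsilon> p \<in> carrier (ring_at ?P T)"
        by (auto simp: X1_power_def poly_ring_def)
    qed (simp_all add: X1_power_def poly_ring_def rename_vars_add rename_vars_mult)
    show "alg_map ?P S T \<epsilon> (scal ?P S k) = scal ?P T k"
      for S T \<epsilon> and k :: 'k
      by (simp add: X1_power_def)
    show "alg_map ?P S S (\<lambda>x\<in>Pt C S. x) p = p"
      if "p \<in> carrier (ring_at ?P S)" for S and p :: "(nat \<times> 'u) multiset \<Rightarrow>\<^sub>0 'k"
    proof -
      have "rename_vars (\<lambda>(i, j). (i, (\<lambda>x\<in>Pt C S. x) j)) p = rename_vars (\<lambda>v. v) p"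
        by (rule rename_vars_cong) (use that in \<open>fastforce simp: X1_power_def poly_ring_def\<close>)
      then show ?thesis
        by (simp add: X1_power_def rename_vars_id)
    qed
    show "alg_map ?P R T (compose (Pt C R) \<epsilon> \<delta>) p =
            alg_map ?P S T \<epsilon> (alg_map ?P R S \<delta> p)"
      if "p \<in> carrier (ring_at ?P R)" for R S T \<delta> \<epsilon> and p :: "(nat \<times> 'u) multiset \<Rightarrow>\<^sub>0 'k"
    proof -
      have "rename_vars (\<lambda>(i, j). (i, compose (Pt C R) \<epsilon> \<delta> j)) p =
          rename_vars ((\<lambda>(i, j). (i, \<epsilon> j)) \<circ> (\<lambda>(i, j). (i, \<delta> j))) p"
        by (rule rename_vars_cong)
          (use that in \<open>fastforce simp: X1_power_def poly_ring_def compose_def\<close>)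
      then show ?thesis
        by (simp add: X1_power_def rename_vars_comp)
    qed
  qed
qed

lemma X1_power_OI_algebra:
  "cat_algebra (type_ring :: 'k::{comm_ring,monoid_mult} ring) (OI \<iota>) (X1_power (OI \<iota>) c)"
  by (rule X1_power_algebra) (auto simp: OI_def)

lemma X1_power_FI_algebra:
  "cat_algebra (type_ring :: 'k::{comm_ring,monoid_mult} ring) (FI \<iota>) (X1_power (FI \<iota>) c)"
  by (rule X1_power_algebra) (auto simp: FI_def)

end

theory Submission
  imports Defs "HOL-Library.Ramsey" "HOL-Library.Sublist"
    "HOL-Library.Product_Lexorder" "HOL-Library.Multiset_Order"
begin

text \<open>
  The proof is a Groebner basis argument in which Higman's lemma takes the place of Dickson's.

  Let \<open>M\<close> be generated by $g_0, \dots, g_{s-1}$ with $g_k \in M_{[d_k]}$.  As a $K$-module, $M_{[n]}$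
  is spanned by the \<^emph>\<open>terms\<close> $m \cdot M(\varepsilon)(g_k)$ with $m$ a monomial and
  $\varepsilon \colon [d_k] \to [n]$ a morphism.  Operators ``apply $M(h)$ for an increasing
  $h \colon [n] \to [n']$, then multiply by a monomial'' send terms to terms.  Three facts about
  them suffice:

  \<^item> Terms of the same level $[n]$ are well-ordered, and every operator is strictly increasing for
    this order (\<open>key_act_strict_mono\<close>).
  \<^item> In every infinite sequence of terms, of varying levels, some infinite subsequence has each
    term carried to every later one by an operator (\<open>terms_wqo\<close>).  A term is a word of length $n$
    whose letter at $j$ records the exponents of the $x_{i,j}$ and the preimages of $j$ under
    $\varepsilon$; an operator is an embedding of words.  This is where Higman's lemma enters.
  \<^item> $K$ is noetherian, so among infinitely many leading coefficients one lies in the ideal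
    generated by the earlier ones.

  If a submodule were not finitely generated, one could choose elements $q_0, q_1, \dots$ of it, each
  outside what the earlier ones generate and with the least leading term possible at its level.  By
  the second and the third fact, some $q_b$ has the same leading term and coefficient as an element
  generated by the earlier ones; subtracting that element leaves one with a smaller leading term, a
  contradiction (\<open>stable_family_finitely_generated\<close>).

  The argument never forms a free module: ``leading term'' is a relation between elements of \<open>M\<close> and
  terms, and an element may have several.  It uses only increasing maps as operators but allows
  arbitrary morphisms $\varepsilon$ inside terms, so that the same proof covers $\mathrm{OI}$ and
  $\mathrm{FI}$.
\<close>


section \<open>Well-quasi-orders and Higman's lemma\<close>

text \<open>
  Well-quasi-orders in the form in which they are used: passing to a subsequence makes a sequence
  ascend between any two of its positions.  In this form finite products are immediate.
\<close>

definition wqo :: "('a \<Rightarrow> 'a \<Rightarrow> bool) \<Rightarrow> bool" where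
  "wqo P \<longleftrightarrow> (\<forall>f :: nat \<Rightarrow> 'a. \<exists>\<phi> :: nat \<Rightarrow> nat. strict_mono \<phi> \<and> (\<forall>i j. i < j \<longrightarrow> P (f (\<phi> i)) (f (\<phi> j))))"

lemma wqoE:
  assumes "wqo P"
  obtains \<phi> :: "nat \<Rightarrow> nat" where "strict_mono \<phi>" "\<And>i j. i < j \<Longrightarrow> P (f (\<phi> i)) (f (\<phi> j))"
  using assms unfolding wqo_def by blast

text \<open>
  Ramsey's theorem: colour a pair of positions by whether \<open>P\<close> holds between them.  A homogeneous
  infinite set of the wrong colour would itself be a sequence without any ascent.
\<close>

lemma wqo_if_no_bad_sequence:
  assumes good: "\<And>f :: nat \<Rightarrow> 'a. \<exists>i j. i < j \<and> P (f i) (f j)"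
  shows "wqo P"
  unfolding wqo_def
proof
  fix f :: "nat \<Rightarrow> 'a"
  define g where "g X = (if P (f (Min X)) (f (Max X)) then 0 else 1 :: nat)" for X
  obtain Y t where Y: "infinite Y" "\<forall>x\<in>Y. \<forall>y\<in>Y. x \<noteq> y \<longrightarrow> g {x, y} = t"
  proof -
    have "\<forall>x\<in>UNIV. \<forall>y\<in>UNIV. x \<noteq> y \<longrightarrow> g {x, y} < 2" by (simp add: g_def)
    from Ramsey2[OF infinite_UNIV_nat this] that show thesis by blast
  qed
  define e where "e = enumerate Y"
  have e: "strict_mono e" "e i \<in> Y" for i
    using Y(1) by (auto simp: e_def strict_mono_enumerate enumerate_in_set)
  have eq: "g {e i, e j} = t" and mm: "Min {e i, e j} = e i" "Max {e i, e j} = e j" if "i < j" for i j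
    using Y(2) e that strict_monoD[OF e(1) that] by auto
  obtain i j where "i < j" "P (f (e i)) (f (e j))"
    using good[of "f \<circ> e"] by auto
  then have "t = 0"
    using eq[of i j] mm[of i j] by (simp add: g_def)
  then have "P (f (e i)) (f (e j))" if "i < j" for i j
    using eq[OF that] mm[OF that] by (simp add: g_def split: if_splits)
  with e(1) show "\<exists>\<phi> :: nat \<Rightarrow> nat. strict_mono \<phi> \<and> (\<forall>i j. i < j \<longrightarrow> P (f (\<phi> i)) (f (\<phi> j)))"
    by blast
qed

lemma wqo_nat: "wqo ((\<le>) :: nat \<Rightarrow> nat \<Rightarrow> bool)"
proof (rule wqo_if_no_bad_sequence)
  fix f :: "nat \<Rightarrow> nat"
  obtain i where "\<forall>j. f i \<le> f j"
    using ex_has_least_nat[of "\<lambda>_. True" 0 f] by auto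
  then show "\<exists>i j. i < j \<and> f i \<le> f j"
    using lessI by blast
qed

lemma wqo_conj:
  assumes "wqo P" "wqo Q"
  shows "wqo (\<lambda>x y. P x y \<and> Q x y)"
  unfolding wqo_def
proof
  fix f :: "nat \<Rightarrow> 'a"
  obtain \<phi> :: "nat \<Rightarrow> nat" where \<phi>: "strict_mono \<phi>" "\<And>i j. i < j \<Longrightarrow> P (f (\<phi> i)) (f (\<phi> j))"
    by (rule wqoE[OF assms(1), of f]) blast
  obtain \<psi> :: "nat \<Rightarrow> nat" where \<psi>: "strict_mono \<psi>" "\<And>i j. i < j \<Longrightarrow> Q (f (\<phi> (\<psi> i))) (f (\<phi> (\<psi> j)))"
    by (rule wqoE[OF assms(2), of "\<lambda>i. f (\<phi> i)"]) blast
  show "\<exists>\<phi> :: nat \<Rightarrow> nat. strict_mono \<phi> \<and> (\<forall>i j. i < j \<longrightarrow> P (f (\<phi> i)) (f (\<phi> j)) \<and> Q (f (\<phi> i)) (f (\<phi> j)))"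
    using \<phi> \<psi> by (intro exI[of _ "\<phi> \<circ> \<psi>"]) (simp add: strict_mono_def)
qed

lemma wqo_vimage: "wqo P \<Longrightarrow> wqo (\<lambda>x y. P (g x) (g y))"
  unfolding wqo_def by (rule allI, drule_tac x = "\<lambda>i. g (f i)" in spec) simp

lemma wqo_mono:
  assumes "wqo P" "\<And>x y. P x y \<Longrightarrow> Q x y"
  shows "wqo Q"
  unfolding wqo_def
proof
  fix f :: "nat \<Rightarrow> 'a"
  obtain \<phi> :: "nat \<Rightarrow> nat" where \<phi>: "strict_mono \<phi>" "\<And>i j. i < j \<Longrightarrow> P (f (\<phi> i)) (f (\<phi> j))"
    by (rule wqoE[OF assms(1), of f]) blast
  then show "\<exists>\<phi> :: nat \<Rightarrow> nat. strict_mono \<phi> \<and> (\<forall>i j. i < j \<longrightarrow> Q (f (\<phi> i)) (f (\<phi> j)))"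
    using assms(2) by (intro exI[of _ \<phi>]) simp
qed

text \<open>
  Each coordinate costs one further passage to a subsequence.
\<close>

lemma dickson:
  assumes "finite B"
  shows "wqo (\<lambda>f g :: 'b \<Rightarrow> nat. \<forall>x\<in>B. f x \<le> g x)"
  using assms
proof (induction B)
  case empty
  show ?case by (auto simp: wqo_def intro: exI[of _ id] strict_mono_id)
next
  case (insert b B)
  show ?case
    using wqo_conj[OF wqo_vimage[OF wqo_nat, of "\<lambda>f. f b"] insert.IH]
    unfolding ball_simps .
qed

text \<open>
  Nash-Williams' minimal bad sequence argument.  Take a bad sequence that has, at each position, the
  shortest word possible given the words before it.  Pass to a subsequence along which the first
  letters ascend and delete these letters: the result, put behind the untouched beginning, is again
  bad and has a shorter word at the position where the deletion starts.
\<close>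

lemma higman:
  assumes P: "wqo P"
  shows "wqo (list_emb P)"
proof (rule wqo_if_no_bad_sequence, rule ccontr)
  define bad where "bad f \<longleftrightarrow> (\<forall>i j. i < j \<longrightarrow> \<not> list_emb P (f i) (f j))" for f :: "nat \<Rightarrow> 'a list"
  fix f0 :: "nat \<Rightarrow> 'a list"
  assume "\<nexists>i j. i < j \<and> list_emb P (f0 i) (f0 j)"
  then have f0: "bad f0" by (auto simp: bad_def)
  \<comment> \<open>\<open>x\<close> continues the first \<open>n\<close> words of \<open>f\<close> to an infinite bad sequence.\<close>
  define ext where "ext f n x \<longleftrightarrow> (\<exists>g. bad g \<and> (\<forall>i<n. g i = f i) \<and> g n = x)"
    for f :: "nat \<Rightarrow> 'a list" and n x
  define Q where "Q f n x \<longleftrightarrow> ((\<exists>x. ext f n x) \<longrightarrow> ext f n x \<and> (\<forall>y. ext f n y \<longrightarrow> length x \<le> length y))"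
    for f n x
  have "\<exists>f. \<forall>n. Q f n (f n)"
  proof (rule dependent_wellorder_choice)
    fix r and f g :: "nat \<Rightarrow> 'a list" and n :: nat
    assume "\<And>y. y < n \<Longrightarrow> f y = g y"
    then have "ext f n = ext g n" by (auto simp: ext_def fun_eq_iff)
    then show "Q f n r = Q g n r" by (simp add: Q_def)
  next
    fix f :: "nat \<Rightarrow> 'a list" and n :: nat
    show "\<exists>r. Q f n r"
    proof (cases "\<exists>x. ext f n x")
      case True
      then show ?thesis
        using ex_has_least_nat[of "ext f n" _ length] unfolding Q_def by blast
    qed (simp add: Q_def)
  qed
  then obtain f where f: "\<And>n. Q f n (f n)" by blast
  have ex: "\<exists>g. bad g \<and> (\<forall>i<n. g i = f i)" for n
  proof (induction n)
    case 0 then show ?case using f0 by auto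
  next
    case (Suc n)
    then have "\<exists>x. ext f n x" by (auto simp: ext_def)
    then have "ext f n (f n)" using f[of n] by (simp add: Q_def)
    then show ?case by (auto simp: ext_def less_Suc_eq)
  qed
  then have min: "length (f n) \<le> length (g n)" if "bad g" "\<forall>i<n. g i = f i" for g n
    using f[of n] that unfolding Q_def ext_def by blast
  have bad: "bad f"
    unfolding bad_def
  proof (intro allI impI)
    fix i j :: nat assume "i < j"
    obtain g where "bad g" "\<forall>i<Suc j. g i = f i" using ex by blast
    moreover from this \<open>i < j\<close> have "g i = f i" "g j = f j" by auto
    ultimately show "\<not> list_emb P (f i) (f j)" using \<open>i < j\<close> unfolding bad_def by metis
  qed
  have nonempty: "f n \<noteq> []" for n
    using bad[unfolded bad_def, rule_format, of n "Suc n"] by auto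
  obtain \<phi> :: "nat \<Rightarrow> nat" where \<phi>: "strict_mono \<phi>" "\<And>i j. i < j \<Longrightarrow> P (hd (f (\<phi> i))) (hd (f (\<phi> j)))"
    by (rule wqoE[OF P, of "\<lambda>n. hd (f n)"]) blast
  define g where "g i = (if i < \<phi> 0 then f i else tl (f (\<phi> (i - \<phi> 0))))" for i
  have "\<not> list_emb P (g i) (g j)" if "i < j" for i j
  proof
    assume emb: "list_emb P (g i) (g j)"
    have badD: "\<not> list_emb P (f a) (f b)" if "a < b" for a b
      using bad that by (simp add: bad_def)
    show False
    proof (cases "j < \<phi> 0")
      case True
      then show False using emb badD[of i j] that by (simp add: g_def)
    next
      case j: False
      let ?j = "j - \<phi> 0"
      show False
      proof (cases "i < \<phi> 0")
        case True
        then have "list_emb P (f i) (f (\<phi> ?j))"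
          using list_emb_Cons[of P "f i" "tl (f (\<phi> ?j))" "hd (f (\<phi> ?j))"] True emb j nonempty
          by (simp add: g_def)
        moreover have "i < \<phi> ?j"
          using True \<phi>(1) by (meson le0 less_le_trans strict_mono_less_eq)
        ultimately show False using badD by blast
      next
        case False
        let ?i = "i - \<phi> 0"
        have "?i < ?j" using False that by simp
        then have "list_emb P (f (\<phi> ?i)) (f (\<phi> ?j))"
          using list_emb_Cons2[of P, OF \<phi>(2)[of ?i ?j], of "tl (f (\<phi> ?i))" "tl (f (\<phi> ?j))"]
            emb j False nonempty
          by (simp add: g_def)
        moreover have "\<phi> ?i < \<phi> ?j"
          using \<open>?i < ?j\<close> \<phi>(1) by (simp add: strict_monoD)
        ultimately show False using badD by blast
      qed
    qed
  qed
  then have "bad g" by (simp add: bad_def)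
  then have "length (f (\<phi> 0)) \<le> length (g (\<phi> 0))"
    by (rule min) (simp add: g_def)
  with nonempty[of "\<phi> 0"] show False by (cases "f (\<phi> 0)") (auto simp: g_def)
qed

text \<open>
  The map \<open>h\<close> is strictly increasing on all natural numbers, not only on the positions of \<open>xs\<close>;
  this keeps side conditions out of the uses of monotonicity below.
\<close>

lemma list_emb_positions:
  assumes "list_emb P xs ys"
  shows "\<exists>h :: nat \<Rightarrow> nat. strict_mono h \<and> (\<forall>i<length xs. h i < length ys \<and> P (xs ! i) (ys ! h i))"
  using assms
proof (induction rule: list_emb.induct)
  case (list_emb_Nil ys)
  show ?case by (auto intro: exI[of _ id] strict_mono_id)
next
  case (list_emb_Cons xs ys y)
  then obtain h where "strict_mono h" "\<forall>i<length xs. h i < length ys \<and> P (xs ! i) (ys ! h i)" by blast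
  then show ?case by (intro exI[of _ "Suc \<circ> h"]) (auto simp: strict_mono_def)
next
  case (list_emb_Cons2 x y xs ys)
  then obtain h where "strict_mono h" "\<forall>i<length xs. h i < length ys \<and> P (xs ! i) (ys ! h i)" by blast
  then show ?case using list_emb_Cons2(1)
    by (intro exI[of _ "case_nat 0 (Suc \<circ> h)"]) (auto simp: strict_mono_def nth_Cons split: nat.split)
qed

text \<open>
  The order-preserving injections $[n] \to [n']$, each extended to a strictly increasing map on the
  natural numbers.
\<close>

definition shifts :: "nat \<Rightarrow> nat \<Rightarrow> (nat \<Rightarrow> nat) set" where
  "shifts n n' = {h. strict_mono h \<and> h ` {1..n} \<subseteq> {1..n'}}"

text \<open>
  A multiset \<open>u\<close> over \<open>{1..n} \<times> B\<close> is a monomial in the variables $x_{b,p}$ with $p \in [n]$.  Reading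
  it position by position gives a word of length \<open>n\<close> whose letters are exponent vectors indexed by
  \<open>B\<close>.  Exponent vectors are well-quasi-ordered by Dickson's lemma, words by Higman's lemma, and an
  embedding of words is a shift that turns one monomial into a divisor of the other.
\<close>

lemma wqo_monomials:
  fixes B :: "'b set"
  assumes "finite B"
  shows "wqo (\<lambda>(n, u) (n', u'). set_mset u \<subseteq> {1..n} \<times> B \<longrightarrow>
    (\<exists>h\<in>shifts n n'. image_mset (map_prod h id) u \<subseteq># u'))"
proof -
  define P where "P f g \<longleftrightarrow> (\<forall>x\<in>B. f x \<le> g x)" for f g :: "'b \<Rightarrow> nat"
  define word where "word = (\<lambda>(n, u). map (\<lambda>p b. count u (Suc p, b)) [0..<n] :: ('b \<Rightarrow> nat) list)"
  have words: "wqo (\<lambda>x y. list_emb P (word x) (word y))"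
    unfolding P_def by (rule wqo_vimage[OF higman[OF dickson[OF assms]]])
  have shift: "\<exists>h\<in>shifts n n'. image_mset (map_prod h id) u \<subseteq># u'"
    if emb: "list_emb P (word (n, u)) (word (n', u'))" and u: "set_mset u \<subseteq> {1..n} \<times> B" for n u n' u'
  proof -
    obtain h where h1: "strict_mono h"
      and emb_h: "\<forall>i<length (word (n, u)). h i < length (word (n', u')) \<and>
        P (word (n, u) ! i) (word (n', u') ! h i)"
      using list_emb_positions[OF emb] by blast
    have h2: "\<forall>i<n. h i < n' \<and> P (\<lambda>b. count u (Suc i, b)) (\<lambda>b. count u' (Suc (h i), b))"
      using emb_h by (simp add: word_def cong: conj_cong)
    note h = h1 h2
    \<comment> \<open>Words are indexed from 0, positions from 1.\<close>
    define k where "k = case_nat 0 (Suc \<circ> h)"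
    have k: "strict_mono k" "k (Suc i) = Suc (h i)" for i
      using h(1) by (auto simp: k_def strict_mono_def split: nat.split)
    have "k \<in> shifts n n'"
    proof -
      have "k i \<in> {1..n'}" if "i \<in> {1..n}" for i
        using that h(2) k(2)[of "i - 1"] by (auto simp: Suc_le_eq)
      then show ?thesis using k(1) by (auto simp: shifts_def)
    qed
    moreover have "image_mset (map_prod k id) u \<subseteq># u'"
    proof (rule mset_subset_eqI)
      fix y
      have inj: "inj (map_prod k id :: nat \<times> 'b \<Rightarrow> _)"
        using k(1) by (intro prod.inj_map) (auto simp: strict_mono_imp_inj_on)
      show "count (image_mset (map_prod k id) u) y \<le> count u' y"
      proof (cases "y \<in># image_mset (map_prod k id) u")
        case True
        then obtain i b where ib: "(i, b) \<in># u" "y = (k i, b)" by auto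
        have cnt: "count (image_mset (map_prod k id) u) (map_prod k id (i, b)) = count u (i, b)"
        proof -
          have "{z. z \<in># u \<and> map_prod k id (i, b) = map_prod k id z} = {(i, b)}"
            using ib injD[OF inj] by blast
          then show ?thesis by (simp add: count_image_mset')
        qed
        have mem: "i \<in> {1..n}" "b \<in> B" using ib u by auto
        then obtain i' where "i = Suc i'" "i' < n" by (cases i) auto
        then show ?thesis using h(2) k(2)[of i'] cnt ib mem by (auto simp: P_def)
      next
        case False
        then have "count (image_mset (map_prod k id) u) y = 0" unfolding not_in_iff .
        then show ?thesis by simp
      qed
    qed
    ultimately show ?thesis by blast
  qed
  show ?thesis
    by (rule wqo_mono[OF words]) (use shift in auto)
qed


section \<open>Linear combinations in modules\<close>

text \<open>
  Linear combinations are built one summand at a time, so that induction peels off single terms,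
  which is how leading terms are found.
\<close>

inductive_set lspan :: "('k, 'r) ring_scheme \<Rightarrow> ('k, 'm, 's) module_scheme \<Rightarrow> 'm set \<Rightarrow> 'm set"
  for K (structure) and V (structure) and X where
  zero: "\<zero>\<^bsub>V\<^esub> \<in> lspan K V X"
| add: "q \<in> lspan K V X \<Longrightarrow> k \<in> carrier K \<Longrightarrow> x \<in> X \<Longrightarrow> k \<odot>\<^bsub>V\<^esub> x \<oplus>\<^bsub>V\<^esub> q \<in> lspan K V X"

lemma submoduleD:
  assumes "submodule H R M"
  shows "H \<subseteq> carrier M" "\<zero>\<^bsub>M\<^esub> \<in> H"
    and "x \<in> H \<Longrightarrow> y \<in> H \<Longrightarrow> x \<oplus>\<^bsub>M\<^esub> y \<in> H"
    and "a \<in> carrier R \<Longrightarrow> x \<in> H \<Longrightarrow> a \<odot>\<^bsub>M\<^esub> x \<in> H"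
  using assms unfolding submodule_def subgroup_def submodule_axioms_def by auto

context module
begin

lemma submodule_if_closed:
  assumes "H \<subseteq> carrier M" "\<zero>\<^bsub>M\<^esub> \<in> H"
    and "\<And>x y. x \<in> H \<Longrightarrow> y \<in> H \<Longrightarrow> x \<oplus>\<^bsub>M\<^esub> y \<in> H"
    and smult: "\<And>a x. a \<in> carrier R \<Longrightarrow> x \<in> H \<Longrightarrow> a \<odot>\<^bsub>M\<^esub> x \<in> H"
  shows "submodule H R M"
proof (rule submoduleI)
  show "\<ominus>\<^bsub>M\<^esub> x \<in> H" if "x \<in> H" for x
    using smult[of "\<ominus> \<one>" x] smult_l_minus[of \<one> x] that assms(1) by auto
qed (use assms in auto)

lemma lspan_closed:
  assumes "X \<subseteq> carrier M" "q \<in> lspan R M X"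
  shows "q \<in> carrier M"
  using assms(2) by induction (use assms(1) in auto)

lemma lspan_base:
  assumes "X \<subseteq> carrier M" "x \<in> X"
  shows "x \<in> lspan R M X"
proof -
  have "\<one> \<odot>\<^bsub>M\<^esub> x \<oplus>\<^bsub>M\<^esub> \<zero>\<^bsub>M\<^esub> \<in> lspan R M X"
    using assms(2) by (intro lspan.intros) auto
  then show ?thesis using assms by auto
qed

lemma lspan_add:
  assumes X: "X \<subseteq> carrier M" and "p \<in> lspan R M X" and q: "q \<in> lspan R M X"
  shows "p \<oplus>\<^bsub>M\<^esub> q \<in> lspan R M X"
  using assms(2)
proof induction
  case zero
  then show ?case using q lspan_closed[OF X q] by simp
next
  case (add p k x)
  have "k \<odot>\<^bsub>M\<^esub> x \<oplus>\<^bsub>M\<^esub> p \<oplus>\<^bsub>M\<^esub> q = k \<odot>\<^bsub>M\<^esub> x \<oplus>\<^bsub>M\<^esub> (p \<oplus>\<^bsub>M\<^esub> q)"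
    using add X q by (intro M.a_assoc) (auto intro: lspan_closed)
  then show ?case using add by (simp add: lspan.add)
qed

lemma lspan_smult:
  assumes X: "X \<subseteq> carrier M" and a: "a \<in> carrier R" and "q \<in> lspan R M X"
  shows "a \<odot>\<^bsub>M\<^esub> q \<in> lspan R M X"
  using assms(3)
proof induction
  case zero
  then show ?case using a by (simp add: lspan.zero)
next
  case (add q k x)
  have "q \<in> carrier M" using add X by (auto intro: lspan_closed)
  then have "a \<odot>\<^bsub>M\<^esub> (k \<odot>\<^bsub>M\<^esub> x \<oplus>\<^bsub>M\<^esub> q) = (a \<otimes> k) \<odot>\<^bsub>M\<^esub> x \<oplus>\<^bsub>M\<^esub> a \<odot>\<^bsub>M\<^esub> q"
    using add X a by (simp add: smult_r_distr smult_assoc1 subset_iff)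
  then show ?case using add a by (simp add: lspan.add)
qed

lemma lspan_submodule:
  assumes "X \<subseteq> carrier M"
  shows "submodule (lspan R M X) R M"
  using lspan_closed[OF assms] lspan.zero lspan_add[OF assms] lspan_smult[OF assms]
  by (intro submodule_if_closed) auto

lemma lspan_mono:
  assumes "X \<subseteq> Y" "q \<in> lspan R M X"
  shows "q \<in> lspan R M Y"
  using assms(2) by induction (use assms(1) in \<open>auto intro: lspan.intros\<close>)

end

text \<open>
  The two modules may live over different rings: passing from \<open>V\<close> to \<open>W\<close> is used both for maps of
  modules along ring homomorphisms and for restricting the scalars of a fixed module.
\<close>

lemma lspan_image:
  assumes V: "module K V" and W: "module L W"
    and X: "X \<subseteq> carrier V" and Y: "Y \<subseteq> carrier W"
    and add: "\<And>p q. p \<in> carrier V \<Longrightarrow> q \<in> carrier V \<Longrightarrow> f (p \<oplus>\<^bsub>V\<^esub> q) = f p \<oplus>\<^bsub>W\<^esub> f q"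
    and zero: "f \<zero>\<^bsub>V\<^esub> = \<zero>\<^bsub>W\<^esub>"
    and base: "\<And>k x. k \<in> carrier K \<Longrightarrow> x \<in> X \<Longrightarrow> f (k \<odot>\<^bsub>V\<^esub> x) \<in> lspan L W Y"
    and q: "q \<in> lspan K V X"
  shows "f q \<in> lspan L W Y"
proof -
  interpret V: module K V by fact
  interpret W: module L W by fact
  show ?thesis
    using q
  proof induction
    case zero
    then show ?case by (simp add: assms(6) lspan.zero)
  next
    case (add q k x)
    have "f (k \<odot>\<^bsub>V\<^esub> x \<oplus>\<^bsub>V\<^esub> q) = f (k \<odot>\<^bsub>V\<^esub> x) \<oplus>\<^bsub>W\<^esub> f q"
      using add X by (intro assms(5)) (auto intro: V.lspan_closed)
    then show ?case using add base W.lspan_add[OF Y] by simp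
  qed
qed

text \<open>
  The ascending chain condition, in the form used for sequences of leading coefficients.
\<close>

lemma (in noetherian_ring) eventually_in_earlier_ideal:
  fixes r :: "nat \<Rightarrow> 'a"
  assumes r: "\<And>i. r i \<in> carrier R"
  shows "\<exists>b. r b \<in> Idl (r ` {..<b})"
proof -
  define C where "C = range (\<lambda>b. Idl (r ` {..<b}))"
  have sub: "r ` {..<b} \<subseteq> carrier R" for b using r by auto
  have mono: "Idl (r ` {..<a}) \<subseteq> Idl (r ` {..<b})" if "a \<le> b" for a b
    using genideal_self[OF sub, of b] that
    by (intro genideal_minimal genideal_ideal sub) (auto simp: image_subset_iff)
  have "subset.chain {I. ideal I R} C"
    unfolding C_def subset_chain_def
    by (auto intro!: genideal_ideal sub) (use mono nat_le_linear in blast)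
  then have "\<Union>C \<in> C"
    by (intro ideal_chain_is_trivial) (auto simp: C_def)
  then obtain b where b: "\<Union>C = Idl (r ` {..<b})" by (auto simp: C_def)
  have "r b \<in> Idl (r ` {..<Suc b})"
    using genideal_self[OF sub, of "Suc b"] by auto
  then show ?thesis using b by (auto simp: C_def)
qed

section \<open>Groebner noetherianity\<close>

text \<open>
  The setting of the Groebner argument.  At each level \<open>n\<close> there is a \<open>K\<close>-module \<open>V n\<close> spanned by the
  values \<open>ev n t\<close> of terms \<open>t\<close>, which need not be linearly independent.  The injective function
  \<open>key\<close> well-orders the terms of a level.  Operators act compatibly on terms and on elements.
\<close>

locale monomial_system =
  fixes K :: "'k ring"
    and V :: "'i \<Rightarrow> ('k, 'm) module"
    and T :: "'i \<Rightarrow> 't set"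
    and ev :: "'i \<Rightarrow> 't \<Rightarrow> 'm"
    and key :: "'t \<Rightarrow> 'w::wellorder"
    and Op :: "'i \<Rightarrow> 'i \<Rightarrow> 'x set"
    and actT :: "'i \<Rightarrow> 'i \<Rightarrow> 'x \<Rightarrow> 't \<Rightarrow> 't"
    and actV :: "'i \<Rightarrow> 'i \<Rightarrow> 'x \<Rightarrow> 'm \<Rightarrow> 'm"
  assumes noetherian: "noetherian_ring K"
    and V_module: "module K (V n)"
    and ev_closed: "t \<in> T n \<Longrightarrow> ev n t \<in> carrier (V n)"
    and spanned: "carrier (V n) \<subseteq> lspan K (V n) (ev n ` T n)"
    and key_inj: "inj_on key (T n)"
    and actT_closed: "x \<in> Op n n' \<Longrightarrow> t \<in> T n \<Longrightarrow> actT n n' x t \<in> T n'"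
    and actV_closed: "x \<in> Op n n' \<Longrightarrow> q \<in> carrier (V n) \<Longrightarrow> actV n n' x q \<in> carrier (V n')"
    and actV_add: "x \<in> Op n n' \<Longrightarrow> p \<in> carrier (V n) \<Longrightarrow> q \<in> carrier (V n) \<Longrightarrow>
      actV n n' x (p \<oplus>\<^bsub>V n\<^esub> q) = actV n n' x p \<oplus>\<^bsub>V n'\<^esub> actV n n' x q"
    and actV_smult: "x \<in> Op n n' \<Longrightarrow> k \<in> carrier K \<Longrightarrow> q \<in> carrier (V n) \<Longrightarrow>
      actV n n' x (k \<odot>\<^bsub>V n\<^esub> q) = k \<odot>\<^bsub>V n'\<^esub> actV n n' x q"
    and actV_ev: "x \<in> Op n n' \<Longrightarrow> t \<in> T n \<Longrightarrow> actV n n' x (ev n t) = ev n' (actT n n' x t)"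
    and key_strict_mono: "x \<in> Op n n' \<Longrightarrow> s \<in> T n \<Longrightarrow> t \<in> T n \<Longrightarrow> key s < key t \<Longrightarrow>
      key (actT n n' x s) < key (actT n n' x t)"
    and divisibility_wqo:
      "wqo (\<lambda>(n, t) (n', t'). t \<in> T n \<longrightarrow> t' \<in> T n' \<longrightarrow> (\<exists>x\<in>Op n n'. actT n n' x t = t'))"
begin

definition stable_family :: "('i \<Rightarrow> 'm set) \<Rightarrow> bool" where
  "stable_family N \<longleftrightarrow> (\<forall>n. submodule (N n) K (V n)) \<and>
    (\<forall>n n'. \<forall>x\<in>Op n n'. actV n n' x ` N n \<subseteq> N n')"

text \<open>
  The part at level \<open>n\<close> of the least stable family that contains \<open>G\<close>.
\<close>

definition generated :: "('i \<times> 'm) set \<Rightarrow> 'i \<Rightarrow> 'm set" where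
  "generated G n = {q \<in> carrier (V n). \<forall>N. stable_family N \<longrightarrow> G \<subseteq> Sigma UNIV N \<longrightarrow> q \<in> N n}"

definition smaller :: "'i \<Rightarrow> 't \<Rightarrow> 'm set" where
  "smaller n t = lspan K (V n) (ev n ` {s \<in> T n. key s < key t})"

text \<open>
  Leading terms are relative to a way of writing \<open>q\<close> as a combination of terms.  Since terms may be
  dependent, \<open>q\<close> can have several leading terms, and the leading coefficient \<open>r\<close> can be zero.
\<close>

definition leading :: "'i \<Rightarrow> 't \<Rightarrow> 'k \<Rightarrow> 'm \<Rightarrow> bool" where
  "leading n t r q \<longleftrightarrow> t \<in> T n \<and> r \<in> carrier K \<and>
    (\<exists>s\<in>smaller n t. q = r \<odot>\<^bsub>V n\<^esub> ev n t \<oplus>\<^bsub>V n\<^esub> s)"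

lemma smaller_base: "ev n ` {s \<in> T n. key s < key t} \<subseteq> carrier (V n)"
  by (auto intro: ev_closed)

lemma smaller_submodule: "submodule (smaller n t) K (V n)"
  unfolding smaller_def by (rule module.lspan_submodule[OF V_module smaller_base])

lemmas smaller_rules = submoduleD[OF smaller_submodule]

lemma leading_closed:
  assumes "leading n t r q"
  shows "q \<in> carrier (V n)"
proof -
  interpret V: module K "V n" by (rule V_module)
  show ?thesis
    using assms smaller_rules(1) by (auto simp: leading_def intro!: ev_closed)
qed

text \<open>
  Adding one summand either replaces the leading term by a larger one, or leaves it, or adds to its
  coefficient.  A coefficient that cancels does no harm, as leading coefficients may be zero.
\<close>

lemma leading_exists:
  assumes "q \<in> lspan K (V n) (ev n ` X)" "X \<subseteq> T n" "q \<noteq> \<zero>\<^bsub>V n\<^esub>"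
  shows "\<exists>t\<in>X. \<exists>r. leading n t r q"
proof -
  interpret V: module K "V n" by (rule V_module)
  have "q = \<zero>\<^bsub>V n\<^esub> \<or> (\<exists>t\<in>X. \<exists>r. leading n t r q)"
    using assms(1)
  proof induction
    case zero
    show ?case by simp
  next
    case (add q k x)
    then obtain t where t: "t \<in> X" "x = ev n t" by auto
    then have tT: "t \<in> T n" using assms(2) by auto
    note [simp] = ev_closed[OF tT]
    have qc: "q \<in> carrier (V n)"
      using V.lspan_closed[OF _ add(1)] assms(2) ev_closed by auto
    from add.IH show ?case
    proof (elim disjE bexE exE)
      assume "q = \<zero>\<^bsub>V n\<^esub>"
      then have "leading n t k (k \<odot>\<^bsub>V n\<^esub> x \<oplus>\<^bsub>V n\<^esub> q)"
        unfolding leading_def using t tT add(2) by (intro conjI bexI[OF _ smaller_rules(2)]) auto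
      then show ?thesis using t by blast
    next
      fix u r assume u: "u \<in> X" and lead: "leading n u r q"
      then obtain s where s: "s \<in> smaller n u" "q = r \<odot>\<^bsub>V n\<^esub> ev n u \<oplus>\<^bsub>V n\<^esub> s"
        and uT: "u \<in> T n" and r: "r \<in> carrier K"
        by (auto simp: leading_def)
      have sc: "s \<in> carrier (V n)" using s smaller_rules(1) by blast
      note [simp] = ev_closed[OF uT]
      consider "key t < key u" | "key u < key t" | "t = u"
        using key_inj tT uT by (meson inj_onD linorder_cases)
      then show ?thesis
      proof cases
        case 1
        then have "ev n t \<in> smaller n u"
          unfolding smaller_def using tT by (intro V.lspan_base smaller_base) auto
        then have "k \<odot>\<^bsub>V n\<^esub> ev n t \<oplus>\<^bsub>V n\<^esub> s \<in> smaller n u"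
          using s add(2) by (intro smaller_rules)
        moreover have "k \<odot>\<^bsub>V n\<^esub> x \<oplus>\<^bsub>V n\<^esub> q = r \<odot>\<^bsub>V n\<^esub> ev n u \<oplus>\<^bsub>V n\<^esub> (k \<odot>\<^bsub>V n\<^esub> ev n t \<oplus>\<^bsub>V n\<^esub> s)"
          using s t r sc add(2) by (simp add: V.M.a_lcomm)
        ultimately have "leading n u r (k \<odot>\<^bsub>V n\<^esub> x \<oplus>\<^bsub>V n\<^esub> q)"
          using uT r by (auto simp: leading_def)
        then show ?thesis using u by blast
      next
        case 2
        have "ev n u \<in> smaller n t"
          unfolding smaller_def using uT 2 by (intro V.lspan_base smaller_base) auto
        moreover have "s \<in> smaller n t"
          unfolding smaller_def by (rule V.lspan_mono[OF _ s(1)[unfolded smaller_def]]) (use 2 in auto)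
        ultimately have "q \<in> smaller n t"
          unfolding s(2) using r by (intro smaller_rules)
        then have "leading n t k (k \<odot>\<^bsub>V n\<^esub> x \<oplus>\<^bsub>V n\<^esub> q)"
          using t tT add(2) by (auto simp: leading_def)
        then show ?thesis using t by blast
      next
        case 3
        have "k \<odot>\<^bsub>V n\<^esub> x \<oplus>\<^bsub>V n\<^esub> q = (k \<oplus>\<^bsub>K\<^esub> r) \<odot>\<^bsub>V n\<^esub> ev n t \<oplus>\<^bsub>V n\<^esub> s"
          using s t r sc add(2) 3 by (simp add: V.smult_l_distr V.M.a_assoc)
        then have "leading n t (k \<oplus>\<^bsub>K\<^esub> r) (k \<odot>\<^bsub>V n\<^esub> x \<oplus>\<^bsub>V n\<^esub> q)"
          using s 3 tT r add(2) by (auto simp: leading_def)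
        then show ?thesis using t by blast
      qed
    qed
  qed
  then show ?thesis using assms(3) by blast
qed

text \<open>
  Operators carry leading terms to leading terms because they are strictly increasing on terms.
\<close>

lemma leading_act:
  assumes x: "x \<in> Op n n'" and "leading n t r q"
  shows "leading n' (actT n n' x t) r (actV n n' x q)"
proof -
  interpret V: module K "V n" by (rule V_module)
  interpret W: module K "V n'" by (rule V_module)
  obtain s where s: "s \<in> smaller n t" "q = r \<odot>\<^bsub>V n\<^esub> ev n t \<oplus>\<^bsub>V n\<^esub> s"
    and t: "t \<in> T n" and r: "r \<in> carrier K"
    using assms(2) by (auto simp: leading_def)
  have sc: "s \<in> carrier (V n)" using s smaller_rules(1) by blast
  have "actV n n' x \<zero>\<^bsub>V n\<^esub> = \<zero>\<^bsub>V n'\<^esub>"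
    using actV_smult[OF x V.R.zero_closed V.M.zero_closed] actV_closed[OF x V.M.zero_closed] by simp
  moreover have "actV n n' x s \<in> smaller n' (actT n n' x t)" if zero: "actV n n' x \<zero>\<^bsub>V n\<^esub> = \<zero>\<^bsub>V n'\<^esub>"
    unfolding smaller_def
  proof (rule lspan_image[where f = "actV n n' x" and q
      = s, OF V_module V_module smaller_base smaller_base])
    fix k z assume k: "k \<in> carrier K" and "z \<in> ev n ` {s \<in> T n. key s < key t}"
    then obtain u where u: "u \<in> T n" "key u < key t" "z = ev n u" by auto
    have "ev n' (actT n n' x u) \<in> lspan K (V n') (ev n' ` {s \<in> T n'. key s < key (actT n n' x t)})"
      using x u t actT_closed key_strict_mono by (intro W.lspan_base smaller_base) auto
    then show "actV n n' x (k \<odot>\<^bsub>V n\<^esub> z) \<in> lspan K (V n') (ev n' ` {s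
        \<in> T n'. key s < key (actT n n' x t)})"
      using x u k by (simp add: actV_smult actV_ev ev_closed W.lspan_smult[OF smaller_base])
  qed (use x zero s(1) in \<open>simp_all add: actV_add smaller_def\<close>)
  moreover have "actV n n' x q = r \<odot>\<^bsub>V n'\<^esub> ev n' (actT n n' x t) \<oplus>\<^bsub>V n'\<^esub> actV n n' x s"
    using s t r sc x by (simp add: actV_add actV_smult actV_ev ev_closed)
  ultimately show ?thesis
    using x t r actT_closed by (auto simp: leading_def)
qed

text \<open>
  Together with \<open>genideal_minimal\<close>, this realises every \<open>K\<close>-combination of leading coefficients at \<open>t\<close>
  as a leading coefficient at \<open>t\<close>, without writing the combination down.
\<close>

lemma leading_coefficients_ideal:
  assumes "submodule H K (V n)" and t: "t \<in> T n"
  shows "ideal {r. \<exists>q\<in>H. leading n t r q} K"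
proof -
  interpret V: module K "V n" by (rule V_module)
  note H = submoduleD[OF assms(1)]
  note [simp] = ev_closed[OF t]
  let ?J = "{r. \<exists>q\<in>H. leading n t r q}"
  have zero: "\<zero>\<^bsub>K\<^esub> \<in> ?J"
    using H(2) t smaller_rules(2)[of n t] by (auto simp: leading_def intro!: bexI[of _ "\<zero>\<^bsub>V n\<^esub>"])
  have add: "a \<oplus>\<^bsub>K\<^esub> b \<in> ?J" if ab: "a \<in> ?J" "b \<in> ?J" for a b
  proof -
    obtain p q s u where p: "p \<in> H" "p = a \<odot>\<^bsub>V n\<^esub> ev n t \<oplus>\<^bsub>V n\<^esub> s" "s \<in> smaller n t" "a \<in> carrier K"
      and q: "q \<in> H" "q = b \<odot>\<^bsub>V n\<^esub> ev n t \<oplus>\<^bsub>V n\<^esub> u" "u \<in> smaller n t" "b \<in> carrier K"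
      using ab by (auto simp: leading_def)
    have c: "s \<in> carrier (V n)" "u \<in> carrier (V n)" using p q smaller_rules(1) by blast+
    have "p \<oplus>\<^bsub>V n\<^esub> q = (a \<oplus>\<^bsub>K\<^esub> b) \<odot>\<^bsub>V n\<^esub> ev n t \<oplus>\<^bsub>V n\<^esub> (s \<oplus>\<^bsub>V n\<^esub> u)"
      using p q c by (simp add: V.smult_l_distr V.M.a_ac)
    then have "leading n t (a \<oplus>\<^bsub>K\<^esub> b) (p \<oplus>\<^bsub>V n\<^esub> q)"
      using p q t smaller_rules(3) by (auto simp: leading_def)
    then show ?thesis using p q H(3) by blast
  qed
  have smult: "k \<otimes>\<^bsub>K\<^esub> a \<in> ?J" if a: "a \<in> ?J" and k: "k \<in> carrier K" for a k
  proof -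
    obtain p s where p: "p \<in> H" "p = a \<odot>\<^bsub>V n\<^esub> ev n t \<oplus>\<^bsub>V n\<^esub> s" "s \<in> smaller n t" "a \<in> carrier K"
      using a by (auto simp: leading_def)
    have c: "s \<in> carrier (V n)" using p smaller_rules(1) by blast
    have "k \<odot>\<^bsub>V n\<^esub> p = (k \<otimes>\<^bsub>K\<^esub> a) \<odot>\<^bsub>V n\<^esub> ev n t \<oplus>\<^bsub>V n\<^esub> (k \<odot>\<^bsub>V n\<^esub> s)"
      using p c k by (simp add: V.smult_r_distr V.smult_assoc1)
    then have "leading n t (k \<otimes>\<^bsub>K\<^esub> a) (k \<odot>\<^bsub>V n\<^esub> p)"
      using p t k smaller_rules(4) by (auto simp: leading_def)
    then show ?thesis using p k H(4) by blast
  qed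
  have sub: "?J \<subseteq> carrier K" by (auto simp: leading_def)
  have neg: "\<ominus>\<^bsub>K\<^esub> a \<in> ?J" if "a \<in> ?J" for a
  proof -
    have "\<ominus>\<^bsub>K\<^esub> \<one>\<^bsub>K\<^esub> \<otimes>\<^bsub>K\<^esub> a = \<ominus>\<^bsub>K\<^esub> a" using that sub by (subst V.R.l_minus) auto
    then show ?thesis using smult[OF that, of "\<ominus>\<^bsub>K\<^esub> \<one>\<^bsub>K\<^esub>"] by simp
  qed
  show ?thesis
  proof (rule idealI)
    show "ring K" by (rule V.R.ring_axioms)
    show "subgroup ?J (add_monoid K)"
      using sub zero add neg by (intro V.R.add.subgroupI) (auto simp: a_inv_def)
    show "k \<otimes>\<^bsub>K\<^esub> a \<in> ?J" "a \<otimes>\<^bsub>K\<^esub> k \<in> ?J" if "a \<in> ?J" "k \<in> carrier K" for a k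
    proof -
      have "a \<otimes>\<^bsub>K\<^esub> k = k \<otimes>\<^bsub>K\<^esub> a" using that sub by (intro V.R.m_comm) auto
      then show "k \<otimes>\<^bsub>K\<^esub> a \<in> ?J" "a \<otimes>\<^bsub>K\<^esub> k \<in> ?J" using smult[OF that] by simp_all
    qed
  qed
qed

lemma generated_submodule: "submodule (generated G n) K (V n)"
proof -
  interpret V: module K "V n" by (rule V_module)
  show ?thesis
    by (rule V.submodule_if_closed) (auto simp: generated_def stable_family_def dest: submoduleD)
qed

lemma generated_base: "(n, q) \<in> G \<Longrightarrow> q \<in> carrier (V n) \<Longrightarrow> q \<in> generated G n"
  by (auto simp: generated_def)

lemma generated_act:
  "x \<in> Op n n' \<Longrightarrow> q \<in> generated G n \<Longrightarrow> actV n n' x q \<in> generated G n'"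
  by (fastforce simp: generated_def actV_closed stable_family_def)

lemma generated_least:
  "stable_family N \<Longrightarrow> G \<subseteq> Sigma UNIV N \<Longrightarrow> generated G n \<subseteq> N n"
  by (auto simp: generated_def)

text \<open>
  The minimal bad sequence argument: each \<open>q b\<close> lies outside what \<open>q 0, \<dots>, q (b - 1)\<close> generate and has
  the least leading term among such elements of its level.  Along a subsequence \<open>\<phi>\<close>, operators carry
  each leading term to all later ones; the noetherian property then provides a \<open>b\<close> for which the
  earlier elements generate some \<open>p\<close> with the leading term and the leading coefficient of
  \<open>q (\<phi> b)\<close>, and the difference contradicts the minimality of that leading term.
\<close>

theorem stable_family_finitely_generated:
  assumes N: "stable_family N"
  shows "\<exists>G. finite G \<and> G \<subseteq> Sigma UNIV N \<and> (\<forall>n. N n \<subseteq> generated G n)"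
proof (rule ccontr)
  assume "\<not> ?thesis"
  then have bad: "\<exists>n q. q \<in> N n - generated G n" if "finite G" "G \<subseteq> Sigma UNIV N" for G
    using that by blast
  have N_sub: "submodule (N n) K (V n)" for n using N by (simp add: stable_family_def)
  define least_bad where "least_bad G z \<longleftrightarrow> (case z of (n, q, t, r) \<Rightarrow>
      q \<in> N n - generated G n \<and> leading n t r q \<and>
      (\<forall>q' t' r'. q' \<in> N n - generated G n \<longrightarrow> leading n t' r' q' \<longrightarrow> key t \<le> key t'))" for G z
  have least_bad_exists: "\<exists>z. least_bad G z" if G: "finite G" "G \<subseteq> Sigma UNIV N" for G
  proof -
    obtain n q where q: "q \<in> N n - generated G n" using bad[OF G] by blast
    define W where "W w \<longleftrightarrow> (\<exists>q t r. q \<in> N n - generated G n \<and> leading n t r q \<and> key t = w)" for w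
    have "q \<noteq> \<zero>\<^bsub>V n\<^esub>" using q submoduleD(2)[OF generated_submodule] by auto
    moreover have "q \<in> lspan K (V n) (ev n ` T n)"
      using q submoduleD(1)[OF N_sub] spanned by blast
    ultimately obtain t r where "leading n t r q"
      using leading_exists by blast
    then have "W (key t)" using q by (auto simp: W_def)
    then have "W (LEAST w. W w)" by (rule LeastI)
    then obtain q t r where q: "q \<in> N n - generated G n" "leading n t r q"
      and key: "key t = (LEAST w. W w)"
      unfolding W_def by blast
    have "key t \<le> w" if "W w" for w
      unfolding key using that by (rule Least_le)
    then have "least_bad G (n, q, t, r)"
      using q by (auto simp: least_bad_def W_def)
    then show ?thesis ..
  qed
  define earlier where "earlier F b = (\<lambda>a. (fst (F a), fst (snd (F a)))) ` {..<b}"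
    for F :: "nat \<Rightarrow> 'i \<times> 'm \<times> 't \<times> 'k" and b
  have "\<exists>F. \<forall>b. least_bad (earlier F b) (F b)"
  proof (rule dependent_wellorder_choice)
    fix F G :: "nat \<Rightarrow> 'i \<times> 'm \<times> 't \<times> 'k" and b :: nat and z
    assume "\<And>a. a < b \<Longrightarrow> F a = G a"
    then have "earlier F b = earlier G b" by (auto simp: earlier_def)
    then show "least_bad (earlier F b) z = least_bad (earlier G b) z" by simp
  next
    fix F :: "nat \<Rightarrow> 'i \<times> 'm \<times> 't \<times> 'k" and b :: nat
    assume "\<And>a. a < b \<Longrightarrow> least_bad (earlier F a) (F a)"
    then have "earlier F b \<subseteq> Sigma UNIV N"
      by (fastforce simp: earlier_def least_bad_def)
    then show "\<exists>z. least_bad (earlier F b) z"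
      by (intro least_bad_exists) (auto simp: earlier_def)
  qed
  then obtain F where F: "\<And>b. least_bad (earlier F b) (F b)" by blast
  define n q t r where "n b = fst (F b)" and "q b = fst (snd (F b))"
    and "t b = fst (snd (snd (F b)))" and "r b = snd (snd (snd (F b)))" for b
  define G where "G b = (\<lambda>a. (n a, q a)) ` {..<b}" for b
  have "least_bad (G b) (n b, q b, t b, r b)" for b
    using F[of b] by (simp add: G_def earlier_def n_def q_def t_def r_def)
  then have q: "q b \<in> N (n b)" "q b \<notin> generated (G b) (n b)" and lead: "leading (n b) (t b) (r b) (q b)"
    and least: "\<And>q' t' r'. q' \<in> N (n b) \<Longrightarrow> q' \<notin> generated (G b) (n b) \<Longrightarrow>
      leading (n b) t' r' q' \<Longrightarrow> key (t b) \<le> key t'" for b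
    by (auto simp: least_bad_def)
  have tT: "t b \<in> T (n b)" and rK: "r b \<in> carrier K" for b
    using lead[of b] by (auto simp: leading_def)
  obtain \<phi> :: "nat \<Rightarrow> nat" where \<phi>: "strict_mono \<phi>"
    and "\<And>i j. i < j \<Longrightarrow> (\<lambda>(n, t) (n', t'). t \<in> T n \<longrightarrow> t' \<in> T n' \<longrightarrow> (\<exists>x\<in>Op n n'. actT n n' x t = t'))
      (n (\<phi> i), t (\<phi> i)) (n (\<phi> j), t (\<phi> j))"
    by (rule wqoE[OF divisibility_wqo, of "\<lambda>i. (n i, t i)"]) blast
  then have div: "\<exists>x\<in>Op (n (\<phi> i)) (n (\<phi> j)). actT (n (\<phi> i)) (n (\<phi> j)) x (t (\<phi> i)) = t (\<phi> j)"
    if "i < j" for i j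
    using that tT by auto
  obtain b where b: "r (\<phi> b) \<in> genideal K ((\<lambda>a. r (\<phi> a)) ` {..<b})"
    using noetherian_ring.eventually_in_earlier_ideal[OF noetherian, of "\<lambda>a. r (\<phi> a)"] rK by auto
  let ?b = "\<phi> b"
  interpret V: module K "V (n ?b)" by (rule V_module)
  \<comment> \<open>The operator from \<open>\<phi> a\<close> to \<open>\<phi> b\<close> turns \<open>q (\<phi> a)\<close> into a generated element whose
    leading term is that of \<open>q (\<phi> b)\<close>.\<close>
  have "genideal K ((\<lambda>a. r (\<phi> a)) ` {..<b}) \<subseteq>
      {r. \<exists>p\<in>generated (G ?b) (n ?b). leading (n ?b) (t ?b) r p}"
  proof (intro V.R.genideal_minimal leading_coefficients_ideal generated_submodule tT subsetI)
    fix z assume "z \<in> (\<lambda>a. r (\<phi> a)) ` {..<b}"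
    then obtain a where a: "a < b" "z = r (\<phi> a)" by auto
    obtain x where x: "x \<in> Op (n (\<phi> a)) (n ?b)" "actT (n (\<phi> a)) (n ?b) x (t (\<phi> a)) = t ?b"
      using div[OF a(1)] by blast
    have "\<phi> a < ?b" using \<phi> a(1) by (simp add: strict_monoD)
    then have "q (\<phi> a) \<in> generated (G ?b) (n (\<phi> a))"
      by (intro generated_base leading_closed[OF lead]) (auto simp: G_def)
    then show "z \<in> {r. \<exists>p\<in>generated (G ?b) (n ?b). leading (n ?b) (t ?b) r p}"
      using generated_act[OF x(1)] leading_act[OF x(1) lead] x(2) a(2) by auto
  qed
  then obtain p where p: "p \<in> generated (G ?b) (n ?b)" "leading (n ?b) (t ?b) (r ?b) p"
    using b by auto
  have pN: "p \<in> N (n ?b)"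
    using generated_least[OF N, of "G ?b"] p(1) q(1) by (force simp: G_def)
  define d where "d = q ?b \<oplus>\<^bsub>V (n ?b)\<^esub> (\<ominus>\<^bsub>K\<^esub> \<one>\<^bsub>K\<^esub>) \<odot>\<^bsub>V (n ?b)\<^esub> p"
  have pc: "p \<in> carrier (V (n ?b))" and qc: "q ?b \<in> carrier (V (n ?b))"
    using p(2) lead leading_closed by blast+
  have d_eq: "d = q ?b \<ominus>\<^bsub>V (n ?b)\<^esub> p"
    using pc by (simp add: d_def V.smult_l_minus a_minus_def)
  have "d \<in> N (n ?b)"
    unfolding d_def using q(1) pN by (intro submoduleD[OF N_sub]) auto
  moreover have d_gen: "d \<notin> generated (G ?b) (n ?b)"
  proof
    assume "d \<in> generated (G ?b) (n ?b)"
    then have "d \<oplus>\<^bsub>V (n ?b)\<^esub> p \<in> generated (G ?b) (n ?b)"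
      using p(1) by (rule submoduleD[OF generated_submodule])
    moreover have "d \<oplus>\<^bsub>V (n ?b)\<^esub> p = q ?b"
      using pc qc by (simp add: d_eq a_minus_def V.M.a_assoc V.M.l_neg)
    ultimately show False using q(2) by simp
  qed
  moreover have "d \<in> smaller (n ?b) (t ?b)"
  proof -
    note [simp] = ev_closed[OF tT]
    obtain s u where s: "s \<in> smaller (n ?b) (t ?b)" "q ?b = r ?b \<odot>\<^bsub>V (n ?b)\<^esub> ev (n ?b) (t ?b)
        \<oplus>\<^bsub>V (n ?b)\<^esub> s"
      and u: "u \<in> smaller (n ?b) (t ?b)" "p = r ?b \<odot>\<^bsub>V (n ?b)\<^esub> ev (n ?b) (t ?b) \<oplus>\<^bsub>V (n ?b)\<^esub> u"
      using lead[of ?b] p(2) unfolding leading_def by blast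
    have c: "s \<in> carrier (V (n ?b))" "u \<in> carrier (V (n ?b))" using s u smaller_rules(1) by blast+
    define e where "e = r ?b \<odot>\<^bsub>V (n ?b)\<^esub> ev (n ?b) (t ?b)"
    have e: "e \<in> carrier (V (n ?b))" using rK by (simp add: e_def)
    have "d = (e \<oplus>\<^bsub>V (n ?b)\<^esub> \<ominus>\<^bsub>V (n ?b)\<^esub> e) \<oplus>\<^bsub>V (n ?b)\<^esub> (s \<oplus>\<^bsub>V (n ?b)\<^esub> \<ominus>\<^bsub>V (n ?b)\<^esub> u)"
      unfolding d_eq s(2) u(2) e_def[symmetric] a_minus_def
      using c e by (simp add: V.M.minus_add V.M.a_ac del: V.M.r_neg V.M.l_neg)
    then have "d = s \<oplus>\<^bsub>V (n ?b)\<^esub> (\<ominus>\<^bsub>K\<^esub> \<one>\<^bsub>K\<^esub>) \<odot>\<^bsub>V (n ?b)\<^esub> u"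
      using c e by (simp add: V.M.r_neg V.smult_l_minus)
    then show ?thesis using s u by (auto intro!: smaller_rules)
  qed
  moreover have "d \<noteq> \<zero>\<^bsub>V (n ?b)\<^esub>"
    using d_gen submoduleD(2)[OF generated_submodule] by auto
  ultimately obtain t' r' where "key t' < key (t ?b)" "leading (n ?b) t' r' d"
    unfolding smaller_def using leading_exists[of d "n ?b" "{s \<in> T (n ?b). key s < key (t ?b)}"] by auto
  with least[OF \<open>d \<in> N (n ?b)\<close> d_gen] show False by force
qed

end


section \<open>Restriction of scalars\<close>

text \<open>
  Leading coefficients lie in \<open>K\<close>, so the Groebner argument regards $M_{[n]}$ as a \<open>K\<close>-module.
\<close>

definition restrict_scalars :: "('k \<Rightarrow> 'a) \<Rightarrow> ('a, 'm) module \<Rightarrow> ('k, 'm) module" where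
  "restrict_scalars f M = \<lparr>carrier = carrier M, mult = mult M, one = one M, zero = zero M,
     add = add M, smult = (\<lambda>k q. f k \<odot>\<^bsub>M\<^esub> q)\<rparr>"

lemma restrict_scalars_simps [simp]:
  "carrier (restrict_scalars f M) = carrier M"
  "zero (restrict_scalars f M) = zero M"
  "add (restrict_scalars f M) = add M"
  "k \<odot>\<^bsub>restrict_scalars f M\<^esub> q = f k \<odot>\<^bsub>M\<^esub> q"
  by (simp_all add: restrict_scalars_def)

lemma restrict_scalars_module:
  assumes K: "cring K" and M: "module R M" and f: "f \<in> ring_hom K R"
  shows "module K (restrict_scalars f M)"
proof -
  interpret M: module R M by (rule M)
  note hom = ring_hom_closed[OF f] ring_hom_mult[OF f] ring_hom_add[OF f] ring_hom_one[OF f]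
  show ?thesis
  proof (rule moduleI[OF K])
    show "abelian_group (restrict_scalars f M)"
    proof (rule abelian_groupI)
      show "\<exists>y\<in>carrier (restrict_scalars f M). y \<oplus>\<^bsub>restrict_scalars f M\<^esub> x = \<zero>\<^bsub>restrict_scalars f M\<^esub>"
        if "x \<in> carrier (restrict_scalars f M)" for x
        using that M.M.l_neg[of x] by (intro bexI[of _ "\<ominus>\<^bsub>M\<^esub> x"]) auto
    qed (auto simp: M.M.a_ac)
  qed (auto simp: hom M.smult_l_distr M.smult_r_distr M.smult_assoc1)
qed

lemma restrict_scalars_submodule:
  assumes K: "cring K" and M: "module R M" and f: "f \<in> ring_hom K R" and H: "submodule H R M"
  shows "submodule H K (restrict_scalars f M)"
  using submoduleD[OF H] ring_hom_closed[OF f]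
  by (intro module.submodule_if_closed[OF restrict_scalars_module[OF K M f]]) auto

section \<open>Modules over categories of finite sets\<close>

text \<open>
  What the proof needs to know about $\mathrm{OI}$ and $\mathrm{FI}$.  Order-preserving injections
  between the sets $[n]$ are morphisms, and each object is a retract of some $[n]$, so that a submodule
  is determined by its values at the $[n]$.  Between the $[n]$ there may be further morphisms, as in
  $\mathrm{FI}$.
\<close>

locale standard_category =
  fixes C :: "('o, 'u) set_cat" and \<iota> :: "nat \<Rightarrow> 'u"
  assumes inj_\<iota>: "inj \<iota>"
    and Std_Ob: "Std C n \<in> Ob C"
    and Pt_Std: "Pt C (Std C n) = \<iota> ` {1..n}"
    and Mor_ext: "\<lbrakk>S \<in> Ob C; T \<in> Ob C; \<epsilon> \<in> Mor C S T\<rbrakk> \<Longrightarrow> \<epsilon> \<in> Pt C S \<rightarrow>\<^sub>E Pt C T"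
    and id_Mor: "S \<in> Ob C \<Longrightarrow> (\<lambda>x\<in>Pt C S. x) \<in> Mor C S S"
    and comp_Mor: "\<lbrakk>R \<in> Ob C; S \<in> Ob C; T \<in> Ob C; \<delta> \<in> Mor C R S; \<epsilon> \<in> Mor C S T\<rbrakk> \<Longrightarrow>
      compose (Pt C R) \<epsilon> \<delta> \<in> Mor C R T"
    and shift_Mor: "h \<in> shifts n n' \<Longrightarrow>
      (\<lambda>y\<in>\<iota> ` {1..n}. \<iota> (h (the_inv \<iota> y))) \<in> Mor C (Std C n) (Std C n')"
    and retract_of_Std: "S \<in> Ob C \<Longrightarrow> \<exists>n. \<exists>\<alpha>\<in>Mor C (Std C n) S. \<exists>\<beta>\<in>Mor C S (Std C n).
      compose (Pt C S) \<alpha> \<beta> = (\<lambda>x\<in>Pt C S. x)"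

locale standard_module = standard_category C \<iota> +
    cat_module "type_ring :: 'k::{comm_ring,monoid_mult} ring" C "X1_power C c" M
  for C :: "('o, 'u) set_cat" and \<iota> :: "nat \<Rightarrow> 'u" and c :: nat
    and M :: "('o, 'u, (nat \<times> 'u) multiset \<Rightarrow>\<^sub>0 'k::{comm_ring,monoid_mult}, 'm) cat_mod"
begin

abbreviation "P \<equiv> X1_power C c :: ('k, 'o, 'u, (nat \<times> 'u) multiset \<Rightarrow>\<^sub>0 'k) cat_alg"

lemma ring_at_P: "ring_at P S = poly_ring ({1..c} \<times> Pt C S)"
  by (simp add: X1_power_def)

lemma monomial_closed:
  "set_mset m \<subseteq> {1..c} \<times> Pt C S \<Longrightarrow> Poly_Mapping.single m k \<in> carrier (ring_at P S)"
  by (auto simp: ring_at_P poly_ring_def)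

lemma mod_map_smult_id:
  assumes "S \<in> Ob C" "T \<in> Ob C" "\<epsilon> \<in> Mor C S T" "a \<in> carrier (ring_at P S)" "q \<in> carrier (mod_at M S)"
  shows "mod_map M S T \<epsilon> (a \<odot>\<^bsub>mod_at M S\<^esub> q) = alg_map P S T \<epsilon> a \<odot>\<^bsub>mod_at M T\<^esub> mod_map M S T \<epsilon> q"
proof -
  have "compose (Pt C S) \<epsilon> (\<lambda>x\<in>Pt C S. x) = \<epsilon>"
    using Mor_ext[OF assms(1-3)] by (auto simp: compose_def PiE_def extensional_def fun_eq_iff)
  then show ?thesis
    using mod_map_smult[OF assms(1) assms(1) assms(2) id_Mor[OF assms(1)] assms(3-5)]
      alg_map_id[OF assms(1,4)] by simp
qed

lemma mod_map_zero:
  assumes "S \<in> Ob C" "T \<in> Ob C" "\<epsilon> \<in> Mor C S T"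
  shows "mod_map M S T \<epsilon> \<zero>\<^bsub>mod_at M S\<^esub> = \<zero>\<^bsub>mod_at M T\<^esub>"
proof -
  interpret S: module "ring_at P S" "mod_at M S" by (rule mod_at_module[OF assms(1)])
  interpret T: module "ring_at P T" "mod_at M T" by (rule mod_at_module[OF assms(2)])
  let ?z = "mod_map M S T \<epsilon> \<zero>\<^bsub>mod_at M S\<^esub>"
  have z: "?z \<in> carrier (mod_at M T)" by (rule mod_map_closed[OF assms S.M.zero_closed])
  have "?z \<oplus>\<^bsub>mod_at M T\<^esub> ?z = ?z"
    using mod_map_add[OF assms S.M.zero_closed S.M.zero_closed] by simp
  then show ?thesis using T.M.add.l_cancel_one[OF z z] by simp
qed

lemma submodule_of_submodule:
  assumes N: "cat_submodule C P M N" and N': "cat_submodule C P (as_module M N) N'"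
  shows "cat_submodule C P M N'" and "S \<in> Ob C \<Longrightarrow> N' S \<subseteq> N S"
proof -
  have closed: "N' S \<subseteq> N S" "\<zero>\<^bsub>mod_at M S\<^esub> \<in> N' S"
      "\<And>x y. x \<in> N' S \<Longrightarrow> y \<in> N' S \<Longrightarrow> x \<oplus>\<^bsub>mod_at M S\<^esub> y \<in> N' S"
      "\<And>a x. a \<in> carrier (ring_at P S) \<Longrightarrow> x \<in> N' S \<Longrightarrow> a \<odot>\<^bsub>mod_at M S\<^esub> x \<in> N' S"
    if "S \<in> Ob C" for S
  proof -
    have "submodule (N' S) (ring_at P S) (mod_at M S\<lparr>carrier := N S\<rparr>)"
      using N' that by (simp add: cat_submodule_def as_module_def)
    from submoduleD[OF this] show "N' S \<subseteq> N S" "\<zero>\<^bsub>mod_at M S\<^esub> \<in> N' S"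
      "\<And>x y. x \<in> N' S \<Longrightarrow> y \<in> N' S \<Longrightarrow> x \<oplus>\<^bsub>mod_at M S\<^esub> y \<in> N' S"
      "\<And>a x. a \<in> carrier (ring_at P S) \<Longrightarrow> x \<in> N' S \<Longrightarrow> a \<odot>\<^bsub>mod_at M S\<^esub> x \<in> N' S"
      by simp_all
  qed
  then show "S \<in> Ob C \<Longrightarrow> N' S \<subseteq> N S" by blast
  show "cat_submodule C P M N'"
    unfolding cat_submodule_def
  proof (intro conjI ballI)
    fix S assume S: "S \<in> Ob C"
    have "N S \<subseteq> carrier (mod_at M S)"
      using N S by (auto simp: cat_submodule_def dest: submoduleD(1))
    then show "submodule (N' S) (ring_at P S) (mod_at M S)"
      using closed[OF S] by (intro module.submodule_if_closed[OF mod_at_module[OF S]]) auto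
  qed (use N' in \<open>simp add: cat_submodule_def as_module_def\<close>)
qed

lemma cat_submodule_map:
  assumes "cat_submodule C P M N" "S \<in> Ob C" "T \<in> Ob C" "\<epsilon> \<in> Mor C S T" "q \<in> N S"
  shows "mod_map M S T \<epsilon> q \<in> N T"
  using assms unfolding cat_submodule_def by blast

definition shift_map :: "nat \<Rightarrow> (nat \<Rightarrow> nat) \<Rightarrow> 'u \<Rightarrow> 'u" where
  "shift_map n h = (\<lambda>y\<in>\<iota> ` {1..n}. \<iota> (h (the_inv \<iota> y)))"

lemma shift_map_Mor: "h \<in> shifts n n' \<Longrightarrow> shift_map n h \<in> Mor C (Std C n) (Std C n')"
  unfolding shift_map_def by (rule shift_Mor)

lemma the_inv_\<iota> [simp]: "the_inv \<iota> (\<iota> i) = i"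
  by (rule the_inv_f_f[OF inj_\<iota>])

end

text \<open>
  Generators are numbered, so that the number can be part of the well-ordered key of a term.
\<close>

locale generated_module = standard_module C \<iota> c M
  for C :: "('o, 'u) set_cat" and \<iota> :: "nat \<Rightarrow> 'u" and c :: nat
    and M :: "('o, 'u, (nat \<times> 'u) multiset \<Rightarrow>\<^sub>0 'k::{comm_ring,monoid_mult}, 'm) cat_mod" +
  fixes gs :: "(nat \<times> 'm) list"
  assumes gs_closed: "set gs \<subseteq> (SIGMA n:UNIV. carrier (mod_at M (Std C n)))"
    and gs_generate: "\<not> (\<exists>N. proper_submodule C P M N \<and> set gs \<subseteq> (SIGMA n:UNIV. N (Std C n)))"
    and noetherian_K: "noetherian_ring (type_ring :: 'k ring)"
begin

definition dg :: "nat \<Rightarrow> nat" where "dg k = fst (gs ! k)"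

definition gen :: "nat \<Rightarrow> 'm" where "gen k = snd (gs ! k)"

lemma gen_closed: "k < length gs \<Longrightarrow> gen k \<in> carrier (mod_at M (Std C (dg k)))"
  using gs_closed nth_mem[of k gs] unfolding dg_def gen_def by (cases "gs ! k") auto

definition V :: "nat \<Rightarrow> ('k, 'm) module" where
  "V n = restrict_scalars (scal P (Std C n)) (mod_at M (Std C n))"

text \<open>
  The triple \<open>(k, m, \<epsilon>)\<close> stands for the monomial \<open>m\<close> times the image under \<open>\<epsilon>\<close> of the \<open>k\<close>-th
  generator.  In \<open>ops\<close>, the pair \<open>(a, h)\<close> stands for the map induced by \<open>h\<close>, followed by
  multiplication by the monomial \<open>a\<close>.
\<close>

definition terms :: "nat \<Rightarrow> (nat \<times> (nat \<times> 'u) multiset \<times> ('u \<Rightarrow> 'u)) set" where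
  "terms n = {(k, m, \<epsilon>). k < length gs \<and> set_mset m \<subseteq> {1..c} \<times> \<iota> ` {1..n} \<and>
     \<epsilon> \<in> Mor C (Std C (dg k)) (Std C n)}"

definition ev :: "nat \<Rightarrow> nat \<times> (nat \<times> 'u) multiset \<times> ('u \<Rightarrow> 'u) \<Rightarrow> 'm" where
  "ev n = (\<lambda>(k, m, \<epsilon>). Poly_Mapping.single m 1 \<odot>\<^bsub>mod_at M (Std C n)\<^esub>
     mod_map M (Std C (dg k)) (Std C n) \<epsilon> (gen k))"

text \<open>
  A term is turned into a single monomial by treating the morphism \<open>\<epsilon>\<close> as the product of new variables
  $y_{l,\varepsilon(l)}$ for $l \in [d]$.  The variable $x_{i,j}$ becomes \<open>(j, i)\<close> and $y_{l,j}$ becomes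
  \<open>(j, c + l)\<close>; they do not clash because $1 \le i \le c$ and $l \ge 1$.  The multiset order is then a
  well-order on terms that both multiplication and shifts respect, and divisibility of codes up to
  shifts is divisibility of terms, since each $y_l$ occurs exactly once.
\<close>

definition code :: "nat \<Rightarrow> (nat \<times> 'u) multiset \<Rightarrow> ('u \<Rightarrow> 'u) \<Rightarrow> (nat \<times> nat) multiset" where
  "code d m \<epsilon> = image_mset (\<lambda>(i, y). (the_inv \<iota> y, i)) m +
     image_mset (\<lambda>l. (the_inv \<iota> (\<epsilon> (\<iota> l)), c + l)) (mset_set {1..d})"

definition key :: "nat \<times> (nat \<times> 'u) multiset \<times> ('u \<Rightarrow> 'u) \<Rightarrow> nat \<times> (nat \<times> nat) multiset" where
  "key = (\<lambda>(k, m, \<epsilon>). (k, code (dg k) m \<epsilon>))"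

definition ops :: "nat \<Rightarrow> nat \<Rightarrow> ((nat \<times> 'u) multiset \<times> (nat \<Rightarrow> nat)) set" where
  "ops n n' = {(a, h). set_mset a \<subseteq> {1..c} \<times> \<iota> ` {1..n'} \<and> h \<in> shifts n n'}"

definition term_act :: "nat \<Rightarrow> (nat \<times> 'u) multiset \<times> (nat \<Rightarrow> nat) \<Rightarrow>
    nat \<times> (nat \<times> 'u) multiset \<times> ('u \<Rightarrow> 'u) \<Rightarrow> nat \<times> (nat \<times> 'u) multiset \<times> ('u \<Rightarrow> 'u)" where
  "term_act n = (\<lambda>(a, h) (k, m, \<epsilon>). (k, a + image_mset (\<lambda>(i, y). (i, shift_map n h y)) m,
     compose (\<iota> ` {1..dg k}) (shift_map n h) \<epsilon>))"

definition mod_act :: "nat \<Rightarrow> nat \<Rightarrow> (nat \<times> 'u) multiset \<times> (nat \<Rightarrow> nat) \<Rightarrow> 'm \<Rightarrow> 'm" where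
  "mod_act n n' = (\<lambda>(a, h) q. Poly_Mapping.single a 1 \<odot>\<^bsub>mod_at M (Std C n')\<^esub>
     mod_map M (Std C n) (Std C n') (shift_map n h) q)"

lemma V_module: "module type_ring (V n)"
  unfolding V_def
  by (rule restrict_scalars_module[OF K_cring mod_at_module[OF Std_Ob] scal_hom[OF Std_Ob]])

lemma Mor_Std: "\<epsilon> \<in> Mor C (Std C d) (Std C n) \<Longrightarrow> \<epsilon> \<in> \<iota> ` {1..d} \<rightarrow>\<^sub>E \<iota> ` {1..n}"
  using Mor_ext[OF Std_Ob Std_Ob] by (simp add: Pt_Std)

lemma code_monomial_part:
  assumes "set_mset m \<subseteq> {1..c} \<times> \<iota> ` {1..n}"
  shows "filter_mset (\<lambda>z. snd z \<le> c) (code d m \<epsilon>) = image_mset (\<lambda>(i, y). (the_inv \<iota> y, i)) m"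
proof -
  have "filter_mset (\<lambda>z. snd z \<le> c) (image_mset (\<lambda>(i, y). (the_inv \<iota> y, i)) m) =
      image_mset (\<lambda>(i, y). (the_inv \<iota> y, i)) m"
    using assms by (subst filter_mset_eq_conv) auto
  moreover have "filter_mset (\<lambda>z. snd z \<le> c)
      (image_mset (\<lambda>l. (the_inv \<iota> (\<epsilon> (\<iota> l)), c + l)) (mset_set {1..d})) = {#}"
    by auto
  ultimately show ?thesis by (simp add: code_def)
qed

lemma code_mark:
  assumes "set_mset m \<subseteq> {1..c} \<times> \<iota> ` {1..n}" "l \<in> {1..d}"
  shows "(p, c + l) \<in># code d m \<epsilon> \<longleftrightarrow> p = the_inv \<iota> (\<epsilon> (\<iota> l))"
  using assms by (fastforce simp: code_def)

lemma decode_monomial: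
  assumes "set_mset m \<subseteq> {1..c} \<times> \<iota> ` {1..n}"
  shows "image_mset (\<lambda>(p, i). (i, \<iota> p)) (image_mset (\<lambda>(i, y). (the_inv \<iota> y, i)) m) = m"
  unfolding multiset.map_comp by (rule multiset.map_ident_strong) (use assms in auto)

lemma code_inj:
  assumes m: "set_mset m \<subseteq> {1..c} \<times> \<iota> ` {1..n}" "set_mset m' \<subseteq> {1..c} \<times> \<iota> ` {1..n}"
    and \<epsilon>: "\<epsilon> \<in> Mor C (Std C d) (Std C n)" "\<epsilon>' \<in> Mor C (Std C d) (Std C n)"
    and eq: "code d m \<epsilon> = code d m' \<epsilon>'"
  shows "m = m' \<and> \<epsilon> = \<epsilon>'"
proof
  have "image_mset (\<lambda>(i, y). (the_inv \<iota> y, i)) m = image_mset (\<lambda>(i, y). (the_inv \<iota> y, i)) m'"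
    unfolding code_monomial_part[OF m(1), of d \<epsilon>, symmetric] code_monomial_part[OF m(2), of d \<epsilon>',
        symmetric] eq
    by (rule refl)
  from arg_cong[OF this, of "image_mset (\<lambda>(p, i). (i, \<iota> p))"] show "m = m'"
    unfolding decode_monomial[OF m(1)] decode_monomial[OF m(2)] .
  show "\<epsilon> = \<epsilon>'"
  proof (rule PiE_ext[OF Mor_Std[OF \<epsilon>(1)] Mor_Std[OF \<epsilon>(2)]])
    fix y assume y: "y \<in> \<iota> ` {1..d}"
    then obtain l where l: "l \<in> {1..d}" "y = \<iota> l" by auto
    have "(the_inv \<iota> (\<epsilon> y), c + l) \<in># code d m \<epsilon>"
      using code_mark[OF m(1) l(1), of _ \<epsilon>] l(2) by simp
    then have "the_inv \<iota> (\<epsilon> y) = the_inv \<iota> (\<epsilon>' y)"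
      unfolding eq code_mark[OF m(2) l(1), of _ \<epsilon>'] l(2) .
    then have eq_\<iota>: "\<iota> (the_inv \<iota> (\<epsilon> y)) = \<iota> (the_inv \<iota> (\<epsilon>' y))"
      by (rule arg_cong)
    have "\<epsilon> y \<in> range \<iota>" "\<epsilon>' y \<in> range \<iota>"
      using PiE_mem[OF Mor_Std[OF \<epsilon>(1)] y] PiE_mem[OF Mor_Std[OF \<epsilon>(2)] y] by blast+
    note range = this[THEN f_the_inv_into_f[OF inj_\<iota>]]
    show "\<epsilon> y = \<epsilon>' y" by (rule box_equals[OF eq_\<iota> range])
  qed
qed

lemma code_act:
  assumes m: "set_mset m \<subseteq> {1..c} \<times> \<iota> ` {1..n}" and \<epsilon>: "\<epsilon> \<in> Mor C (Std C d) (Std C n)"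
  shows "code d (a + image_mset (\<lambda>(i, y). (i, shift_map n h y)) m)
      (compose (\<iota> ` {1..d}) (shift_map n h) \<epsilon>) =
    image_mset (\<lambda>(i, y). (the_inv \<iota> y, i)) a + image_mset (map_prod h id) (code d m \<epsilon>)"
proof -
  have sh: "the_inv \<iota> (shift_map n h y) = h (the_inv \<iota> y)" if "y \<in> \<iota> ` {1..n}" for y
    using that by (auto simp: shift_map_def)
  have "image_mset (\<lambda>(i, y). (the_inv \<iota> y, i)) (image_mset (\<lambda>(i, y). (i, shift_map n h y)) m) =
      image_mset (map_prod h id) (image_mset (\<lambda>(i, y). (the_inv \<iota> y, i)) m)"
    unfolding multiset.map_comp by (rule image_mset_cong) (use m in \<open>auto simp: sh\<close>)
  moreover have "image_mset (\<lambda>l. (the_inv \<iota> (compose (\<iota> ` {1..d}) (shift_map n h) \<epsilon> (\<iota> l)), c + l))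
      (mset_set {1..d}) =
      image_mset (map_prod h id) (image_mset (\<lambda>l. (the_inv \<iota> (\<epsilon> (\<iota> l)), c + l)) (mset_set {1..d}))"
    unfolding multiset.map_comp
  proof (rule image_mset_cong)
    fix l assume "l \<in># mset_set {1..d}"
    then have "\<iota> l \<in> \<iota> ` {1..d}" by simp
    moreover from this have "\<epsilon> (\<iota> l) \<in> \<iota> ` {1..n}" using Mor_Std[OF \<epsilon>] by auto
    ultimately show "(the_inv \<iota> (compose (\<iota> ` {1..d}) (shift_map n h) \<epsilon> (\<iota> l)), c + l) =
      (map_prod h id \<circ> (\<lambda>l. (the_inv \<iota> (\<epsilon> (\<iota> l)), c + l))) l"
      by (simp add: compose_def sh)
  qed
  ultimately show ?thesis by (simp add: code_def)
qed

lemma key_act: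
  assumes "t \<in> terms n" "(a, h) \<in> ops n n'"
  shows "key (term_act n (a, h) t) =
    (fst (key t), image_mset (\<lambda>(i, y). (the_inv \<iota> y, i)) a + image_mset (map_prod h id) (snd (key t)))"
  using assms by (auto simp: terms_def key_def term_act_def code_act simp del: One_nat_def)

lemma key_act_strict_mono:
  assumes "x \<in> ops n n'" "s \<in> terms n" "t \<in> terms n" "key s < key t"
  shows "key (term_act n x s) < key (term_act n x t)"
proof -
  obtain a h where x: "x = (a, h)" by (cases x)
  then have h: "strict_mono h" using assms(1) by (auto simp: ops_def shifts_def)
  have "image_mset (map_prod h id) u < image_mset (map_prod h id) v" if "u < v"
    for u v :: "(nat \<times> nat) multiset"
    by (rule image_mset_strict_mono[OF _ that])
      (use h in \<open>auto simp: strict_mono_less strict_mono_less_eq\<close>)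
  then show ?thesis
    using assms unfolding x
    by (cases "key s"; cases "key t") (auto simp: key_act less_prod_simp)
qed

lemma term_act_closed:
  assumes x: "x \<in> ops n n'" and t: "t \<in> terms n"
  shows "term_act n x t \<in> terms n'"
proof -
  obtain a h k m \<epsilon> where [simp]: "x = (a, h)" "t = (k, m, \<epsilon>)" by (cases x, cases t) auto
  have h: "h \<in> shifts n n'" and a: "set_mset a \<subseteq> {1..c} \<times> \<iota> ` {1..n'}"
    using x by (auto simp: ops_def)
  have t': "k < length gs" "set_mset m \<subseteq> {1..c} \<times> \<iota> ` {1..n}" "\<epsilon> \<in> Mor C (Std C (dg k)) (Std C n)"
    using t by (auto simp: terms_def)
  note sh = shift_map_Mor[OF h]
  have "compose (\<iota> ` {1..dg k}) (shift_map n h) \<epsilon> \<in> Mor C (Std C (dg k)) (Std C n')"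
    using comp_Mor[OF Std_Ob Std_Ob Std_Ob t'(3) sh] by (simp add: Pt_Std)
  moreover have "set_mset (image_mset (\<lambda>(i, y). (i, shift_map n h y)) m) \<subseteq> {1..c} \<times> \<iota> ` {1..n'}"
  proof
    fix z assume "z \<in># image_mset (\<lambda>(i, y). (i, shift_map n h y)) m"
    then obtain i y where z: "(i, y) \<in># m" "z = (i, shift_map n h y)" by auto
    then have "i \<in> {1..c}" "y \<in> \<iota> ` {1..n}" using t'(2) by blast+
    then show "z \<in> {1..c} \<times> \<iota> ` {1..n'}"
      unfolding z(2) using PiE_mem[OF Mor_Std[OF sh]] by blast
  qed
  ultimately show ?thesis
    using t'(1) a by (simp add: terms_def term_act_def)
qed

lemma monomial_smult_closed:
  assumes "set_mset a \<subseteq> {1..c} \<times> \<iota> ` {1..n}" "q \<in> carrier (mod_at M (Std C n))"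
  shows "Poly_Mapping.single a r \<odot>\<^bsub>mod_at M (Std C n)\<^esub> q \<in> carrier (mod_at M (Std C n))"
  using assms by (intro module.smult_closed[OF mod_at_module[OF Std_Ob]] monomial_closed) (simp_all
      add: Pt_Std)

lemma ev_closed:
  assumes "t \<in> terms n"
  shows "ev n t \<in> carrier (mod_at M (Std C n))"
  using assms by (auto simp: terms_def ev_def intro!: monomial_smult_closed mod_map_closed Std_Ob
      gen_closed)

lemma mod_act_closed:
  assumes "x \<in> ops n n'" "q \<in> carrier (mod_at M (Std C n))"
  shows "mod_act n n' x q \<in> carrier (mod_at M (Std C n'))"
  using assms by (auto simp: ops_def mod_act_def intro!: monomial_smult_closed mod_map_closed Std_Ob
      shift_map_Mor)

lemma mod_act_add:
  assumes x: "x \<in> ops n n'" and "p \<in> carrier (mod_at M (Std C n))" "q \<in> carrier (mod_at M (Std C n))"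
  shows "mod_act n n' x (p \<oplus>\<^bsub>mod_at M (Std C n)\<^esub> q) =
    mod_act n n' x p \<oplus>\<^bsub>mod_at M (Std C n')\<^esub> mod_act n n' x q"
proof -
  obtain a h where [simp]: "x = (a, h)" by (cases x)
  have "shift_map n h \<in> Mor C (Std C n) (Std C n')"
    and "Poly_Mapping.single a 1 \<in> carrier (ring_at P (Std C n'))"
    using x by (auto simp: ops_def Pt_Std intro!: shift_map_Mor monomial_closed)
  then show ?thesis
    using assms(2,3) module.smult_r_distr[OF mod_at_module[OF Std_Ob[of n']]]
    by (simp add: mod_act_def mod_map_add mod_map_closed Std_Ob)
qed

lemma scal_closed: "scal P S k \<in> carrier (ring_at P S)"
  by (simp add: X1_power_def poly_ring_def)

lemma mod_act_scal:
  assumes x: "x \<in> ops n n'" and q: "q \<in> carrier (mod_at M (Std C n))"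
  shows "mod_act n n' x (scal P (Std C n) k \<odot>\<^bsub>mod_at M (Std C n)\<^esub> q) =
    scal P (Std C n') k \<odot>\<^bsub>mod_at M (Std C n')\<^esub> mod_act n n' x q"
proof -
  interpret W: module "ring_at P (Std C n')" "mod_at M (Std C n')" by (rule mod_at_module[OF Std_Ob])
  obtain a h where [simp]: "x = (a, h)" by (cases x)
  have sh: "shift_map n h \<in> Mor C (Std C n) (Std C n')"
    and a: "Poly_Mapping.single a 1 \<in> carrier (ring_at P (Std C n'))"
    using x by (auto simp: ops_def Pt_Std intro!: shift_map_Mor monomial_closed)
  have k: "k \<in> carrier type_ring" by (simp add: type_ring_def)
  show ?thesis
    using mod_map_scal[OF Std_Ob Std_Ob sh k q] mod_map_closed[OF Std_Ob Std_Ob sh q] a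
    by (simp add: mod_act_def scal_closed W.smult_assoc1[symmetric] W.R.m_comm[OF a scal_closed])
qed

lemma mod_act_ev:
  assumes x: "x \<in> ops n n'" and t: "t \<in> terms n"
  shows "mod_act n n' x (ev n t) = ev n' (term_act n x t)"
proof -
  interpret W: module "ring_at P (Std C n')" "mod_at M (Std C n')" by (rule mod_at_module[OF Std_Ob])
  obtain a h k m \<epsilon> where [simp]: "x = (a, h)" "t = (k, m, \<epsilon>)" by (cases x, cases t) auto
  have sh: "shift_map n h \<in> Mor C (Std C n) (Std C n')"
    and a: "Poly_Mapping.single a 1 \<in> carrier (ring_at P (Std C n'))"
    using x by (auto simp: ops_def Pt_Std intro!: shift_map_Mor monomial_closed)
  have k: "k < length gs" and m: "Poly_Mapping.single m 1 \<in> carrier (ring_at P (Std C n))"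
    and \<epsilon>: "\<epsilon> \<in> Mor C (Std C (dg k)) (Std C n)"
    using t by (auto simp: terms_def Pt_Std intro!: monomial_closed)
  let ?m = "alg_map P (Std C n) (Std C n') (shift_map n h) (Poly_Mapping.single m 1)"
  let ?g = "mod_map M (Std C n) (Std C n') (shift_map n h) (mod_map M (Std C (dg k)) (Std C n) \<epsilon>
      (gen k))"
  have m': "?m \<in> carrier (ring_at P (Std C n'))"
    by (rule ring_hom_closed[OF alg_map_hom[OF Std_Ob Std_Ob sh] m])
  have g: "mod_map M (Std C (dg k)) (Std C n) \<epsilon> (gen k) \<in> carrier (mod_at M (Std C n))"
    by (rule mod_map_closed[OF Std_Ob Std_Ob \<epsilon> gen_closed[OF k]])
  have "mod_act n n' x (ev n t) = Poly_Mapping.single a 1 \<odot>\<^bsub>mod_at M (Std C n')\<^esub> (?m \<odot>\<^bsub>mod_at M (Std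
      C n')\<^esub> ?g)"
    using mod_map_smult_id[OF Std_Ob Std_Ob sh m g] by (simp add: mod_act_def ev_def)
  also have "\<dots> = (Poly_Mapping.single a 1 \<otimes>\<^bsub>ring_at P (Std C n')\<^esub> ?m) \<odot>\<^bsub>mod_at M (Std C n')\<^esub> ?g"
    using W.smult_assoc1[OF a m' mod_map_closed[OF Std_Ob Std_Ob sh g]] by simp
  also have "Poly_Mapping.single a 1 \<otimes>\<^bsub>ring_at P (Std C n')\<^esub> ?m =
      Poly_Mapping.single (a + image_mset (\<lambda>(i, y). (i, shift_map n h y)) m) 1"
    by (simp add: X1_power_def poly_ring_def mult_single)
  also have "?g = mod_map M (Std C (dg k)) (Std C n') (compose (\<iota> ` {1..dg k}) (shift_map n h) \<epsilon>)
      (gen k)"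
    using mod_map_comp[OF Std_Ob Std_Ob Std_Ob \<epsilon> sh gen_closed[OF k]] by (simp add: Pt_Std)
  finally show ?thesis by (simp add: ev_def term_act_def)
qed

definition images :: "'o \<Rightarrow> 'm set" where
  "images S = {mod_map M (Std C (dg k)) S \<epsilon> (gen k) | k \<epsilon>. k < length gs \<and> \<epsilon> \<in> Mor C (Std C (dg k)) S}"

lemma images_closed: "S \<in> Ob C \<Longrightarrow> images S \<subseteq> carrier (mod_at M S)"
  by (auto simp: images_def intro!: mod_map_closed Std_Ob gen_closed)

text \<open>
  The right-hand side defines a submodule that contains the generators.
\<close>

lemma images_span:
  assumes "S \<in> Ob C"
  shows "carrier (mod_at M S) = lspan (ring_at P S) (mod_at M S) (images S)"
proof -
  define N where "N S = lspan (ring_at P S) (mod_at M S) (images S)" for S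
  have "cat_submodule C P M N"
    unfolding cat_submodule_def
  proof (intro conjI ballI subsetI)
    show "submodule (N S) (ring_at P S) (mod_at M S)" if "S \<in> Ob C" for S
      unfolding N_def by (rule module.lspan_submodule[OF mod_at_module images_closed]) (use that in
          auto)
  next
    fix S T \<epsilon> q assume S: "S \<in> Ob C" and T: "T \<in> Ob C" and \<epsilon>: "\<epsilon> \<in> Mor C S T"
      and "q \<in> mod_map M S T \<epsilon> ` N S"
    then obtain p where p: "q = mod_map M S T \<epsilon> p" "p \<in> lspan (ring_at P S) (mod_at M S) (images S)"
      by (auto simp: N_def)
    interpret W: module "ring_at P T" "mod_at M T" by (rule mod_at_module[OF T])
    show "q \<in> N T"
      unfolding p(1) N_def
    proof (rule lspan_image[where f = "mod_map M S T \<epsilon>" and q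
        = p, OF mod_at_module[OF S] mod_at_module[OF T] images_closed[OF S] images_closed[OF T]])
      fix a x assume a: "a \<in> carrier (ring_at P S)" and x: "x \<in> images S"
      have xc: "x \<in> carrier (mod_at M S)" using x images_closed[OF S] by blast
      have "mod_map M S T \<epsilon> x \<in> images T"
      proof -
        obtain k \<delta> where k: "x = mod_map M (Std C (dg k)) S \<delta> (gen k)" "k < length gs" "\<delta>
            \<in> Mor C (Std C (dg k)) S"
          using x by (auto simp: images_def)
        then have "mod_map M S T \<epsilon> x = mod_map M (Std C (dg k)) T (compose (Pt C (Std C (dg k))) \<epsilon>
            \<delta>) (gen k)"
          using mod_map_comp[OF Std_Ob S T k(3) \<epsilon> gen_closed[OF k(2)]] by simp
        then show ?thesis
          using comp_Mor[OF Std_Ob S T k(3) \<epsilon>] k(2) by (auto simp: images_def)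
      qed
      then have "mod_map M S T \<epsilon> x \<in> lspan (ring_at P T) (mod_at M T) (images T)"
        by (rule W.lspan_base[OF images_closed[OF T]])
      then show "mod_map M S T \<epsilon> (a \<odot>\<^bsub>mod_at M S\<^esub> x) \<in> lspan (ring_at P T) (mod_at M T) (images T)"
        using ring_hom_closed[OF alg_map_hom[OF S T \<epsilon>] a]
        by (simp add: mod_map_smult_id[OF S T \<epsilon> a xc] W.lspan_smult[OF images_closed[OF T]])
    qed (use p(2) mod_map_zero[OF S T \<epsilon>] mod_map_add[OF S T \<epsilon>] in auto)
  qed
  moreover have "set gs \<subseteq> (SIGMA n:UNIV. N (Std C n))"
  proof
    fix z assume "z \<in> set gs"
    then obtain k where k: "k < length gs" "z = (dg k, gen k)"
      by (auto simp: in_set_conv_nth dg_def gen_def)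
    have "gen k = mod_map M (Std C (dg k)) (Std C (dg k)) (\<lambda>x\<in>Pt C (Std C (dg k)). x) (gen k)"
      by (simp only: mod_map_id[OF Std_Ob gen_closed[OF k(1)]])
    then have "gen k \<in> images (Std C (dg k))"
      using id_Mor[OF Std_Ob] k(1) unfolding images_def by blast
    then have "gen k \<in> N (Std C (dg k))"
      unfolding N_def by (rule module.lspan_base[OF mod_at_module[OF Std_Ob] images_closed[OF Std_Ob]])
    then show "z \<in> (SIGMA n:UNIV. N (Std C n))" using k(2) by simp
  qed
  ultimately show ?thesis
    using gs_generate assms unfolding proper_submodule_def N_def[symmetric] by blast
qed

text \<open>
  Splitting the polynomial into monomials turns a combination with polynomial coefficients into one
  of terms with coefficients in \<open>K\<close>.
\<close>

lemma polynomial_times_image_in_span: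
  assumes a: "a \<in> carrier (ring_at P (Std C n))" and k: "k < length gs"
    and \<epsilon>: "\<epsilon> \<in> Mor C (Std C (dg k)) (Std C n)"
  shows "a \<odot>\<^bsub>mod_at M (Std C n)\<^esub> mod_map M (Std C (dg k)) (Std C n) \<epsilon> (gen k)
      \<in> lspan type_ring (V n) (ev n ` terms n)"
    (is "a \<odot>\<^bsub>?M\<^esub> ?x \<in> ?L")
proof -
  interpret W: module "ring_at P (Std C n)" ?M by (rule mod_at_module[OF Std_Ob])
  have x: "?x \<in> carrier ?M" by (rule mod_map_closed[OF Std_Ob Std_Ob \<epsilon> gen_closed[OF k]])
  have vars: "set_mset m \<subseteq> {1..c} \<times> \<iota> ` {1..n}" if "m \<in> Poly_Mapping.keys a" for m
    using a that by (auto simp: ring_at_P poly_ring_def Pt_Std)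
  let ?s = "\<lambda>X. \<Sum>m\<in>X. Poly_Mapping.single m (Poly_Mapping.lookup a m)"
  have add: "p \<oplus>\<^bsub>ring_at P (Std C n)\<^esub> q = p + q" and mult: "p \<otimes>\<^bsub>ring_at P (Std C n)\<^esub> q = p * q"
    and zero: "\<zero>\<^bsub>ring_at P (Std C n)\<^esub> = 0" for p q
    by (simp_all add: ring_at_P poly_ring_def)
  have "?s X \<in> carrier (ring_at P (Std C n)) \<and> ?s X \<odot>\<^bsub>?M\<^esub> ?x \<in> ?L" if "X \<subseteq> Poly_Mapping.keys a" for X
    using finite_subset[OF that finite_keys] that
  proof (induction X)
    case empty
    then show ?case
      using W.smult_l_null[OF x] W.R.zero_closed lspan.zero[where V = "V n"] by (simp add: zero V_def)
  next
    case (insert m X)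
    let ?k = "Poly_Mapping.lookup a m"
    have m: "set_mset m \<subseteq> {1..c} \<times> \<iota> ` {1..n}" using insert vars by auto
    then have mc: "Poly_Mapping.single m r \<in> carrier (ring_at P (Std C n))" for r
      by (intro monomial_closed) (simp add: Pt_Std)
    have IH: "?s X \<in> carrier (ring_at P (Std C n))" "?s X \<odot>\<^bsub>?M\<^esub> ?x \<in> ?L" using insert by auto
    have "Poly_Mapping.single m ?k = scal P (Std C n) ?k \<otimes>\<^bsub>ring_at P (Std C n)\<^esub> Poly_Mapping.single m 1"
      by (simp only: mult) (simp add: X1_power_def mult_single)
    then have "Poly_Mapping.single m ?k \<odot>\<^bsub>?M\<^esub> ?x = ?k \<odot>\<^bsub>V n\<^esub> ev n (k, m, \<epsilon>)"
      using W.smult_assoc1[OF scal_closed mc x] by (simp add: V_def ev_def)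
    then have "?s (insert m X) \<odot>\<^bsub>?M\<^esub> ?x = ?k \<odot>\<^bsub>V n\<^esub> ev n (k, m, \<epsilon>) \<oplus>\<^bsub>V n\<^esub> ?s X \<odot>\<^bsub>?M\<^esub> ?x"
      using insert(1,2) W.smult_l_distr[OF mc IH(1) x] by (simp add: add V_def)
    moreover have "(k, m, \<epsilon>) \<in> terms n" using k m \<epsilon> by (simp add: terms_def)
    ultimately have "?s (insert m X) \<odot>\<^bsub>?M\<^esub> ?x \<in> ?L"
      using lspan.add[OF IH(2), of ?k "ev n (k, m, \<epsilon>)"] by (auto simp: type_ring_def)
    moreover have "?s (insert m X) \<in> carrier (ring_at P (Std C n))"
      using insert(1,2) W.R.a_closed[OF mc IH(1)] by (simp add: add)
    ultimately show ?case by blast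
  qed
  from this[OF order_refl] show ?thesis
    using poly_mapping_expand[of a] by simp
qed

lemma terms_span: "carrier (V n) \<subseteq> lspan type_ring (V n) (ev n ` terms n)"
proof
  interpret V: module type_ring "V n" by (rule V_module)
  fix q assume "q \<in> carrier (V n)"
  then have q: "q \<in> lspan (ring_at P (Std C n)) (mod_at M (Std C n)) (images (Std C n))"
    using images_span[OF Std_Ob] by (simp add: V_def)
  have "(\<lambda>q. q) q \<in> lspan type_ring (V n) (ev n ` terms n)"
  proof (rule lspan_image[where f = "\<lambda>q. q" and q
      = q, OF mod_at_module[OF Std_Ob] V_module images_closed[OF Std_Ob] _ _ _ _ q])
    show "ev n ` terms n \<subseteq> carrier (V n)" using ev_closed by (auto simp: V_def)
    show "a \<odot>\<^bsub>mod_at M (Std C n)\<^esub> x \<in> lspan type_ring (V n) (ev n ` terms n)"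
      if "a \<in> carrier (ring_at P (Std C n))" "x \<in> images (Std C n)" for a x
      using that polynomial_times_image_in_span by (auto simp: images_def)
  qed (simp_all add: V_def)
  then show "q \<in> lspan type_ring (V n) (ev n ` terms n)" .
qed

text \<open>
  The part of the codes in the variables $x$ gives divisibility of the monomials.  In the variables
  $y$, the code of \<open>\<epsilon>'\<close> has only one candidate for the image of \<open>(\<epsilon> l, c + l)\<close>, which forces
  \<open>\<epsilon>' l = h (\<epsilon> l)\<close>.
\<close>

lemma divides_if_code_embeds:
  assumes t: "(k, m, \<epsilon>) \<in> terms n" and t': "(k, m', \<epsilon>') \<in> terms n'" and h: "h \<in> shifts n n'"
    and emb: "image_mset (map_prod h id) (code (dg k) m \<epsilon>) \<subseteq># code (dg k) m' \<epsilon>'"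
  shows "\<exists>x\<in>ops n n'. term_act n x (k, m, \<epsilon>) = (k, m', \<epsilon>')"
proof -
  have m: "set_mset m \<subseteq> {1..c} \<times> \<iota> ` {1..n}" and m': "set_mset m' \<subseteq> {1..c} \<times> \<iota> ` {1..n'}"
    and \<epsilon>: "\<epsilon> \<in> Mor C (Std C (dg k)) (Std C n)" and \<epsilon>': "\<epsilon>' \<in> Mor C (Std C (dg k)) (Std C n')"
    using t t' by (auto simp: terms_def)
  have "filter_mset (\<lambda>z. snd z \<le> c) (image_mset (map_prod h id) (code (dg k) m \<epsilon>)) \<subseteq>#
      filter_mset (\<lambda>z. snd z \<le> c) (code (dg k) m' \<epsilon>')"
    using emb by (rule multiset_filter_mono)
  also have "filter_mset (\<lambda>z. snd z \<le> c) (image_mset (map_prod h id) (code (dg k) m \<epsilon>)) =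
      image_mset (map_prod h id) (image_mset (\<lambda>(i, y). (the_inv \<iota> y, i)) m)"
    using code_monomial_part[OF m] by (simp add: filter_mset_image_mset)
  also have "filter_mset (\<lambda>z. snd z \<le> c) (code (dg k) m' \<epsilon>')
      = image_mset (\<lambda>(i, y). (the_inv \<iota> y, i)) m'"
    by (rule code_monomial_part[OF m'])
  finally have "image_mset (\<lambda>(p, i). (i, \<iota> p)) (image_mset (map_prod h id) (image_mset (\<lambda>(i, y).
      (the_inv \<iota> y, i)) m)) \<subseteq>#
      image_mset (\<lambda>(p, i). (i, \<iota> p)) (image_mset (\<lambda>(i, y). (the_inv \<iota> y, i)) m')"
    by (rule image_mset_subseteq_mono)
  moreover have "image_mset (\<lambda>(p, i). (i, \<iota> p)) (image_mset (map_prod h id) (image_mset (\<lambda>(i, y).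
      (the_inv \<iota> y, i)) m)) =
      image_mset (\<lambda>(i, y). (i, shift_map n h y)) m"
    unfolding multiset.map_comp by (rule image_mset_cong) (use m in \<open>auto simp: shift_map_def\<close>)
  moreover have "image_mset (\<lambda>(p, i). (i, \<iota> p)) (image_mset (\<lambda>(i, y). (the_inv \<iota> y, i)) m') = m'"
    by (rule decode_monomial[OF m'])
  ultimately have sub: "image_mset (\<lambda>(i, y). (i, shift_map n h y)) m \<subseteq># m'" by simp
  have sh: "shift_map n h \<in> \<iota> ` {1..n} \<rightarrow>\<^sub>E \<iota> ` {1..n'}"
    by (rule Mor_Std[OF shift_map_Mor[OF h]])
  have "compose (\<iota> ` {1..dg k}) (shift_map n h) \<epsilon> = \<epsilon>'"
  proof (rule PiE_ext)
    show "compose (\<iota> ` {1..dg k}) (shift_map n h) \<epsilon> \<in> \<iota> ` {1..dg k} \<rightarrow>\<^sub>E \<iota> ` {1..n'}"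
      using Mor_Std[OF \<epsilon>] sh by (auto simp: compose_def)
    show "\<epsilon>' \<in> \<iota> ` {1..dg k} \<rightarrow>\<^sub>E \<iota> ` {1..n'}" by (rule Mor_Std[OF \<epsilon>'])
    fix y assume y: "y \<in> \<iota> ` {1..dg k}"
    then obtain l where l: "l \<in> {1..dg k}" "y = \<iota> l" by auto
    have "(the_inv \<iota> (\<epsilon> y), c + l) \<in># code (dg k) m \<epsilon>"
      using code_mark[OF m l(1)] l(2) by simp
    then have "(h (the_inv \<iota> (\<epsilon> y)), c + l) \<in># image_mset (map_prod h id) (code (dg k) m \<epsilon>)"
      by force
    then have "h (the_inv \<iota> (\<epsilon> y)) = the_inv \<iota> (\<epsilon>' y)"
      using mset_subset_eqD[OF emb] code_mark[OF m' l(1)] l(2) by blast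
    moreover have "\<epsilon> y \<in> \<iota> ` {1..n}" "\<epsilon>' y \<in> range \<iota>"
      using PiE_mem[OF Mor_Std[OF \<epsilon>] y] PiE_mem[OF Mor_Std[OF \<epsilon>'] y] by auto
    ultimately show "compose (\<iota> ` {1..dg k}) (shift_map n h) \<epsilon> y = \<epsilon>' y"
      using y f_the_inv_into_f[OF inj_\<iota>, of "\<epsilon>' y"] by (simp add: compose_def shift_map_def)
  qed
  then have "term_act n (m' - image_mset (\<lambda>(i, y). (i, shift_map n h y)) m, h) (k, m, \<epsilon>) = (k, m', \<epsilon>')"
    using sub by (simp add: term_act_def)
  moreover have "(m' - image_mset (\<lambda>(i, y). (i, shift_map n h y)) m, h) \<in> ops n n'"
    using m' h by (auto simp: ops_def dest: in_diffD)
  ultimately show ?thesis by blast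
qed

text \<open>
  Terms that belong to different generators are never comparable.  Dickson's lemma, applied to the
  indicator functions of the generator numbers, passes to a subsequence with a single generator.
\<close>

lemma terms_wqo:
  "wqo (\<lambda>(n, t) (n', t'). t \<in> terms n \<longrightarrow> t' \<in> terms n' \<longrightarrow> (\<exists>x\<in>ops n n'. term_act n x t = t'))"
proof -
  \<comment> \<open>The codes of all terms must use one finite set \<open>B\<close> of second components.\<close>
  define D where "D = Max (insert 0 (dg ` {..<length gs}))"
  have D: "dg k \<le> D" if "k < length gs" for k
    unfolding D_def using that by (intro Max_ge) auto
  define B where "B = {..c + D}"
  define indicator :: "nat \<Rightarrow> nat \<Rightarrow> nat" where "indicator k = (\<lambda>j. if j = k then 1 else 0)" for k
  define coded where "coded z = (fst z, snd (key (snd z)))"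
    for z :: "nat \<times> nat \<times> (nat \<times> 'u) multiset \<times> ('u \<Rightarrow> 'u)"
  have "finite B" by (simp add: B_def)
  note wqo = wqo_conj[OF wqo_vimage[OF wqo_monomials[OF \<open>finite B\<close>], of coded]
    wqo_vimage[OF dickson[OF finite_lessThan[of "length gs"]], of "\<lambda>z. indicator (fst (snd z))"]]
  show ?thesis
  proof (rule wqo_mono[OF wqo], elim conjE)
    fix z z' :: "nat \<times> nat \<times> (nat \<times> 'u) multiset \<times> ('u \<Rightarrow> 'u)"
    obtain n k m \<epsilon> n' k' m' \<epsilon>' where z: "z = (n, k, m, \<epsilon>)" "z' = (n', k', m', \<epsilon>')"
      by (cases z, cases z') auto
    assume emb: "(case coded z of (n, u) \<Rightarrow> \<lambda>(n', u'). set_mset u \<subseteq> {1..n} \<times> B \<longrightarrow>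
        (\<exists>h\<in>shifts n n'. image_mset (map_prod h id) u \<subseteq># u')) (coded z')"
      and ind: "\<forall>j\<in>{..<length gs}. indicator (fst (snd z)) j \<le> indicator (fst (snd z')) j"
    have "\<exists>x\<in>ops n n'. term_act n x (k, m, \<epsilon>) = (k', m', \<epsilon>')"
      if t: "(k, m, \<epsilon>) \<in> terms n" and t': "(k', m', \<epsilon>') \<in> terms n'"
    proof -
      have k: "k < length gs" and m: "set_mset m \<subseteq> {1..c} \<times> \<iota> ` {1..n}"
        and \<epsilon>: "\<epsilon> \<in> Mor C (Std C (dg k)) (Std C n)"
        using t by (auto simp: terms_def)
      have "indicator k k \<le> indicator k' k" using ind k by (simp add: z)
      then have [simp]: "k' = k" by (simp add: indicator_def split: if_splits)
      have "the_inv \<iota> (\<epsilon> (\<iota> l)) \<in> {1..n}" if "l \<in> {1..dg k}" for l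
      proof -
        have "\<epsilon> (\<iota> l) \<in> \<iota> ` {1..n}" using Mor_Std[OF \<epsilon>] that by auto
        then show ?thesis by auto
      qed
      then have "set_mset (code (dg k) m \<epsilon>) \<subseteq> {1..n} \<times> B"
        using m D[OF k] by (fastforce simp: code_def B_def)
      then obtain h where "h \<in> shifts n n'" "image_mset (map_prod h id) (code (dg k) m \<epsilon>)
          \<subseteq># code (dg k) m' \<epsilon>'"
        using emb by (auto simp: z coded_def key_def)
      then show ?thesis using divides_if_code_embeds t t' by simp
    qed
    then show "(case z of (n, t) \<Rightarrow> \<lambda>(n', t'). t \<in> terms n \<longrightarrow> t' \<in> terms n' \<longrightarrow>
        (\<exists>x\<in>ops n n'. term_act n x t = t')) z'"
      by (simp add: z)
  qed
qed

sublocale monomial_system type_ring V terms ev key ops "\<lambda>n n'. term_act n" mod_act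
proof (rule monomial_system.intro)
  show "noetherian_ring (type_ring :: 'k ring)" by (rule noetherian_K)
  show "module type_ring (V n)" for n by (rule V_module)
  show "carrier (V n) \<subseteq> lspan type_ring (V n) (ev n ` terms n)" for n by (rule terms_span)
  show "inj_on key (terms n)" for n
    by (rule inj_onI) (auto simp: key_def terms_def dest: code_inj simp del: One_nat_def)
  show "wqo (\<lambda>(n, t) (n', t'). t \<in> terms n \<longrightarrow> t' \<in> terms n' \<longrightarrow> (\<exists>x\<in>ops n n'. term_act n x t = t'))"
    by (rule terms_wqo)
qed (simp_all add: V_def ev_closed term_act_closed mod_act_closed mod_act_add mod_act_scal mod_act_ev
    key_act_strict_mono)

lemma stable_family_of_submodule:
  assumes N: "cat_submodule C P M N"
  shows "stable_family (\<lambda>n. N (Std C n))"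
  unfolding stable_family_def
proof (intro conjI allI ballI subsetI)
  have sub: "submodule (N (Std C n)) (ring_at P (Std C n)) (mod_at M (Std C n))" for n
    using N Std_Ob by (simp add: cat_submodule_def)
  then show "submodule (N (Std C n)) type_ring (V n)" for n
    unfolding V_def
    by (rule restrict_scalars_submodule[OF K_cring mod_at_module[OF Std_Ob] scal_hom[OF Std_Ob]])
  fix n n' x z assume x: "x \<in> ops n n'" and "z \<in> mod_act n n' x ` N (Std C n)"
  then obtain a h q where q: "x = (a, h)" "z = mod_act n n' (a, h) q" "q \<in> N (Std C n)"
    by (cases x) auto
  have "mod_map M (Std C n) (Std C n') (shift_map n h) q \<in> N (Std C n')"
    using q x by (intro cat_submodule_map[OF N] Std_Ob shift_map_Mor) (auto simp: ops_def)
  then show "z \<in> N (Std C n')"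
    using q x submoduleD(4)[OF sub] monomial_closed[of a "Std C n'"]
    by (auto simp: mod_act_def ops_def Pt_Std)
qed

theorem noetherian: "noetherian_module C P M"
  unfolding noetherian_module_def
proof (intro allI impI)
  fix N assume N: "cat_submodule C P M N"
  obtain G where G: "finite G" "G \<subseteq> (SIGMA n:UNIV. N (Std C n))" "\<And>n. N (Std C n) \<subseteq> generated G n"
    using stable_family_finitely_generated[OF stable_family_of_submodule[OF N]] by blast
  \<comment> \<open>Agreement at the sets $[n]$ extends to an arbitrary object through its retraction from some $[n]$.\<close>
  have "\<not> proper_submodule C P (as_module M N) N'" if G': "G \<subseteq> (SIGMA n:UNIV. N' (Std C n))" for N'
  proof
    assume "proper_submodule C P (as_module M N) N'"
    then have N': "cat_submodule C P (as_module M N) N'" and "\<exists>S\<in>Ob C. N' S \<noteq> N S"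
      by (auto simp: proper_submodule_def as_module_def)
    then obtain S where S: "S \<in> Ob C" "N' S \<noteq> N S" by blast
    note sub = submodule_of_submodule[OF N N']
    have Std: "N (Std C n) \<subseteq> N' (Std C n)" for n
      using G(3) generated_least[OF stable_family_of_submodule[OF sub(1)] G'] by blast
    obtain n \<alpha> \<beta> where \<alpha>: "\<alpha> \<in> Mor C (Std C n) S" and \<beta>: "\<beta> \<in> Mor C S (Std C n)"
      and id: "compose (Pt C S) \<alpha> \<beta> = (\<lambda>x\<in>Pt C S. x)"
      using retract_of_Std[OF S(1)] by blast
    have "q \<in> N' S" if q: "q \<in> N S" for q
    proof -
      have qc: "q \<in> carrier (mod_at M S)"
        using N S q by (auto simp: cat_submodule_def dest: submoduleD(1))
      have "mod_map M S (Std C n) \<beta> q \<in> N (Std C n)"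
        by (rule cat_submodule_map[OF N S(1) Std_Ob \<beta> q])
      then have "mod_map M S (Std C n) \<beta> q \<in> N' (Std C n)" using Std by blast
      then have "mod_map M (Std C n) S \<alpha> (mod_map M S (Std C n) \<beta> q) \<in> N' S"
        by (rule cat_submodule_map[OF sub(1) Std_Ob S(1) \<alpha>])
      then show ?thesis
        using mod_map_comp[OF S(1) Std_Ob S(1) \<beta> \<alpha> qc] mod_map_id[OF S(1) qc] by (simp add: id)
    qed
    then show False using sub(2)[OF S(1)] S(2) by blast
  qed
  then show "finitely_generated C P (as_module M N)"
    unfolding finitely_generated_def using G(1,2) by (auto simp: as_module_def)
qed

end

theorem finitely_generated_imp_noetherian:
  fixes M :: "('o, 'u, (nat \<times> 'u) multiset \<Rightarrow>\<^sub>0 'k::{comm_ring,monoid_mult}, 'm) cat_mod"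
  assumes C: "standard_category C \<iota>" and K: "noetherian_ring (type_ring :: 'k ring)"
    and M: "cat_module (type_ring :: 'k ring) C (X1_power C c) M"
    and fg: "finitely_generated C (X1_power C c) M"
  shows "noetherian_module C (X1_power C c) M"
proof -
  obtain G where G: "finite G" "G \<subseteq> (SIGMA n:UNIV. carrier (mod_at M (Std C n)))"
    "\<not> (\<exists>N. proper_submodule C (X1_power C c) M N \<and> G \<subseteq> (SIGMA n:UNIV. N (Std C n)))"
    using fg by (auto simp: finitely_generated_def)
  obtain gs where gs: "set gs = G" using finite_list[OF G(1)] by blast
  have "generated_module C \<iota> c M gs"
    using G gs K
    by (intro generated_module.intro standard_module.intro C M generated_module_axioms.intro) simp_all
  then show ?thesis by (rule generated_module.noetherian)
qed

section \<open>The categories FI and OI\<close>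

lemma standard_coordinates:
  assumes \<iota>: "inj \<iota>" and p: "bij_betw p S {1..N}"
  obtains \<alpha> \<beta> where "\<alpha> \<in> \<iota> ` {1..N} \<rightarrow>\<^sub>E S" "inj_on \<alpha> (\<iota> ` {1..N})"
    "\<beta> \<in> S \<rightarrow>\<^sub>E \<iota> ` {1..N}" "inj_on \<beta> S"
    "\<And>x. x \<in> S \<Longrightarrow> \<beta> x = \<iota> (p x)" "\<And>x. x \<in> S \<Longrightarrow> \<alpha> (\<iota> (p x)) = x"
    "compose S \<alpha> \<beta> = (\<lambda>x\<in>S. x)"
proof
  define A where "A = \<iota> ` {1..N}"
  define \<beta> where "\<beta> = (\<lambda>x\<in>S. \<iota> (p x))"
  have A: "A = (\<lambda>x. \<iota> (p x)) ` S"
    unfolding A_def bij_betw_imp_surj_on[OF p, symmetric] by (simp add: image_image)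
  have "inj_on (\<lambda>x. \<iota> (p x)) S"
    using bij_betw_imp_inj_on[OF p] \<iota> by (auto simp: inj_on_def)
  then have "bij_betw (\<lambda>x. \<iota> (p x)) S A" by (simp add: A bij_betw_def)
  then have \<beta>: "bij_betw \<beta> S A"
    by (rule bij_betw_cong[THEN iffD1, rotated]) (simp add: \<beta>_def)
  define \<alpha> where "\<alpha> = restrict (inv_into S \<beta>) A"
  have \<alpha>: "bij_betw \<alpha> A S"
    by (rule bij_betw_cong[THEN iffD1, OF _ bij_betw_inv_into[OF \<beta>]]) (simp add: \<alpha>_def)
  show "inj_on \<alpha> (\<iota> ` {1..N})" "inj_on \<beta> S"
    using \<alpha> \<beta> by (auto simp: bij_betw_def A_def)
  show "\<alpha> \<in> \<iota> ` {1..N} \<rightarrow>\<^sub>E S"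
    using bij_betw_imp_funcset[OF \<alpha>] unfolding A_def[symmetric] by (simp add: \<alpha>_def PiE_def)
  show "\<beta> \<in> S \<rightarrow>\<^sub>E \<iota> ` {1..N}"
    using bij_betw_imp_funcset[OF \<beta>] unfolding A_def[symmetric] by (simp add: \<beta>_def PiE_def)
  show \<beta>_eq: "\<beta> x = \<iota> (p x)" if "x \<in> S" for x
    using that by (simp add: \<beta>_def)
  show \<alpha>_eq: "\<alpha> (\<iota> (p x)) = x" if "x \<in> S" for x
    using that bij_betw_inv_into_left[OF \<beta> that] \<beta>_eq[OF that] by (simp add: \<alpha>_def A)
  show "compose S \<alpha> \<beta> = (\<lambda>x\<in>S. x)"
    by (simp add: compose_def fun_eq_iff restrict_def \<beta>_eq \<alpha>_eq)
qed

lemma compose_injection: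
  assumes "\<delta> \<in> R \<rightarrow>\<^sub>E S" "\<epsilon> \<in> S \<rightarrow>\<^sub>E T" "inj_on \<delta> R" "inj_on \<epsilon> S"
  shows "compose R \<epsilon> \<delta> \<in> R \<rightarrow>\<^sub>E T" "inj_on (compose R \<epsilon> \<delta>) R"
proof -
  have "\<delta> x \<in> S" if "x \<in> R" for x using assms(1) that by auto
  then show "compose R \<epsilon> \<delta> \<in> R \<rightarrow>\<^sub>E T" "inj_on (compose R \<epsilon> \<delta>) R"
    using assms(2-4) by (auto simp: compose_def inj_on_def)
qed

lemma standard_category_FI:
  assumes "inj \<iota>"
  shows "standard_category (FI \<iota>) \<iota>"
proof
  show "inj \<iota>" by fact
  fix n n' :: nat and h assume h: "h \<in> shifts n n'"
  have "\<iota> (h i) \<in> \<iota> ` {1..n'}" if "i \<in> {1..n}" for i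
    using h that unfolding shifts_def by blast
  moreover have "inj_on (\<lambda>y\<in>\<iota> ` {1..n}. \<iota> (h (the_inv \<iota> y))) (\<iota> ` {1..n})"
    using h assms by (intro inj_onI) (auto simp: shifts_def the_inv_f_f inj_eq strict_mono_eq)
  ultimately show "(\<lambda>y\<in>\<iota> ` {1..n}. \<iota> (h (the_inv \<iota> y))) \<in> Mor (FI \<iota>) (Std (FI \<iota>) n) (Std (FI \<iota>) n')"
    using assms by (auto simp: FI_def the_inv_f_f)
next
  fix S assume "S \<in> Ob (FI \<iota>)"
  then have "finite S" by (simp add: FI_def)
  then obtain p where p: "bij_betw p S {1..card S}"
    using ex_bij_betw_nat_finite_1 bij_betw_inv_into by blast
  show "\<exists>n. \<exists>\<alpha>\<in>Mor (FI \<iota>) (Std (FI \<iota>) n) S. \<exists>\<beta>\<in>Mor (FI \<iota>) S (Std (FI \<iota>) n).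
      compose (Pt (FI \<iota>) S) \<alpha> \<beta> = (\<lambda>x\<in>Pt (FI \<iota>) S. x)"
    by (rule standard_coordinates[OF assms p], rule exI[of _ "card S"]) (unfold FI_def, simp, blast)
next
  show "compose (Pt (FI \<iota>) R) \<epsilon> \<delta> \<in> Mor (FI \<iota>) R T"
    if "\<delta> \<in> Mor (FI \<iota>) R S" "\<epsilon> \<in> Mor (FI \<iota>) S T" for R S T \<delta> \<epsilon>
    using that compose_injection[of \<delta> R S \<epsilon> T] by (simp add: FI_def)
qed (auto simp: FI_def)

lemma standard_category_OI:
  assumes "inj \<iota>"
  shows "standard_category (OI \<iota>) \<iota>"
proof
  show "inj \<iota>" by fact
  show "Std (OI \<iota>) n \<in> Ob (OI \<iota>)" for n
    using assms
    by (auto simp: OI_def linear_order_on_def partial_order_on_def preorder_on_def refl_on_def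
        trans_def antisym_def total_on_def inj_eq)
  show "\<epsilon> \<in> Pt (OI \<iota>) S \<rightarrow>\<^sub>E Pt (OI \<iota>) T" if "\<epsilon> \<in> Mor (OI \<iota>) S T" for S T \<epsilon>
    using that by (cases S, cases T) (auto simp: OI_def)
  show "Pt (OI \<iota>) (Std (OI \<iota>) n) = \<iota> ` {1..n}" for n
    by (simp add: OI_def)
  show "(\<lambda>x\<in>Pt (OI \<iota>) S. x) \<in> Mor (OI \<iota>) S S" for S
    by (cases S) (auto simp: OI_def inj_on_def)
  show "compose (Pt (OI \<iota>) R) \<epsilon> \<delta> \<in> Mor (OI \<iota>) R T"
    if "\<delta> \<in> Mor (OI \<iota>) R S" "\<epsilon> \<in> Mor (OI \<iota>) S T" for R S T \<delta> \<epsilon>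
  proof -
    obtain A r B s D t where [simp]: "R = (A, r)" "S = (B, s)" "T = (D, t)"
      by (cases R, cases S, cases T) auto
    have \<delta>: "\<delta> \<in> A \<rightarrow>\<^sub>E B" "inj_on \<delta> A" "\<And>x y. x \<in> A \<Longrightarrow> y \<in> A \<Longrightarrow> (x, y) \<in> r \<Longrightarrow> (\<delta> x, \<delta> y) \<in> s"
      and \<epsilon>: "\<epsilon> \<in> B \<rightarrow>\<^sub>E D" "inj_on \<epsilon> B" "\<And>x y. x \<in> B \<Longrightarrow> y \<in> B \<Longrightarrow> (x, y) \<in> s \<Longrightarrow> (\<epsilon> x, \<epsilon> y) \<in> t"
      using that by (auto simp: OI_def)
    have "\<delta> x \<in> B" if "x \<in> A" for x using \<delta>(1) that by auto
    then show ?thesis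
      using compose_injection[OF \<delta>(1) \<epsilon>(1) \<delta>(2) \<epsilon>(2)] \<delta>(3) \<epsilon>(3) by (simp add: OI_def compose_eq)
  qed
next
  fix n n' :: nat and h assume h: "h \<in> shifts n n'"
  interpret FI: standard_category "FI \<iota>" \<iota> by (rule standard_category_FI[OF assms])
  have "(\<lambda>y\<in>\<iota> ` {1..n}. \<iota> (h (the_inv \<iota> y))) \<in> Mor (FI \<iota>) (Std (FI \<iota>) n) (Std (FI \<iota>) n')"
    by (rule FI.shift_Mor[OF h])
  moreover have "\<exists>i j. \<iota> (h a) = \<iota> i \<and> \<iota> (h b) = \<iota> j \<and> 1 \<le> i \<and> i \<le> j \<and> j \<le> n'"
    if "1 \<le> a" "a \<le> b" "b \<le> n" for a b
  proof (intro exI conjI)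
    have "h a \<in> {1..n'}" "h b \<in> {1..n'}"
      using h that unfolding shifts_def by (auto simp: image_subset_iff)
    then show "1 \<le> h a" "h b \<le> n'" by auto
    show "h a \<le> h b" using h that by (simp add: shifts_def strict_mono_less_eq)
  qed simp_all
  ultimately show "(\<lambda>y\<in>\<iota> ` {1..n}. \<iota> (h (the_inv \<iota> y))) \<in> Mor (OI \<iota>) (Std (OI \<iota>) n) (Std (OI \<iota>) n')"
    using assms by (auto simp: OI_def FI_def the_inv_f_f inj_eq)
next
  fix X assume "X \<in> Ob (OI \<iota>)"
  then obtain S r where X: "X = (S, r)" and S: "finite S" and r: "linear_order_on S r"
    by (auto simp: OI_def)
  \<comment> \<open>The rank of \<open>x\<close> in the finite order \<open>r\<close>, counted from 1, identifies \<open>S\<close> with an initial segment.\<close>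
  define p where "p x = card {y\<in>S. (y, x) \<in> r}" for x
  have refl: "(x, x) \<in> r" if "x \<in> S" for x
    using r that by (auto simp: linear_order_on_def partial_order_on_def preorder_on_def refl_on_def)
  have trans: "(x, z) \<in> r" if "(x, y) \<in> r" "(y, z) \<in> r" for x y z
    using r that unfolding linear_order_on_def partial_order_on_def preorder_on_def trans_def by blast
  have antisym: "x = y" if "(x, y) \<in> r" "(y, x) \<in> r" for x y
    using r that unfolding linear_order_on_def partial_order_on_def antisym_def by blast
  have total: "(x, y) \<in> r \<or> (y, x) \<in> r" if "x \<in> S" "y \<in> S" for x y
  proof (cases "x = y")
    case False
    have "total_on S r" using r by (simp add: linear_order_on_def)
    then show ?thesis using that False by (simp add: total_on_def)
  qed (use refl that in simp)
  have less: "p x < p y" if "x \<in> S" "y \<in> S" "(x, y) \<in> r" "x \<noteq> y" for x y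
    unfolding p_def
  proof (rule psubset_card_mono)
    have "y \<notin> {z\<in>S. (z, x) \<in> r}" "y \<in> {z\<in>S. (z, y) \<in> r}"
      using that refl antisym by blast+
    moreover have "{z\<in>S. (z, x) \<in> r} \<subseteq> {z\<in>S. (z, y) \<in> r}"
      using that trans by blast
    ultimately show "{z\<in>S. (z, x) \<in> r} \<subset> {z\<in>S. (z, y) \<in> r}" by blast
  qed (use S in simp)
  have le_iff: "p x \<le> p y \<longleftrightarrow> (x, y) \<in> r" if "x \<in> S" "y \<in> S" for x y
    using less[OF that] less[OF that(2,1)] total[OF that] by (cases "x = y") auto
  have inj: "inj_on p S"
  proof (rule inj_onI)
    fix x y assume "x \<in> S" "y \<in> S" "p x = p y"
    then show "x = y" using le_iff[of x y] le_iff[of y x] antisym by simp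
  qed
  have "p ` S \<subseteq> {1..card S}"
  proof
    fix i assume "i \<in> p ` S"
    then obtain x where x: "x \<in> S" "i = p x" by auto
    have "x \<in> {y\<in>S. (y, x) \<in> r}" using x refl by simp
    then have "p x \<noteq> 0" using S by (auto simp: p_def)
    moreover have "p x \<le> card S" unfolding p_def using S by (intro card_mono) auto
    ultimately show "i \<in> {1..card S}" using x by simp
  qed
  then have im: "p ` S = {1..card S}"
    by (intro card_subset_eq) (simp_all add: card_image[OF inj])
  then have p: "bij_betw p S {1..card S}"
    using inj by (simp add: bij_betw_def)
  obtain \<alpha> \<beta> where \<alpha>: "\<alpha> \<in> \<iota> ` {1..card S} \<rightarrow>\<^sub>E S" "inj_on \<alpha> (\<iota> ` {1..card S})"
    and \<beta>: "\<beta> \<in> S \<rightarrow>\<^sub>E \<iota> ` {1..card S}" "inj_on \<beta> S"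
    and \<beta>_eq: "\<And>x. x \<in> S \<Longrightarrow> \<beta> x = \<iota> (p x)" and \<alpha>_eq: "\<And>x. x \<in> S \<Longrightarrow> \<alpha> (\<iota> (p x)) = x"
    and id: "compose S \<alpha> \<beta> = (\<lambda>x\<in>S. x)"
    using standard_coordinates[OF assms p] by blast
  have "(\<alpha> (\<iota> i), \<alpha> (\<iota> j)) \<in> r" if "1 \<le> i" "i \<le> j" "j \<le> card S" for i j
  proof -
    have "i \<in> p ` S" "j \<in> p ` S" using that im by auto
    then show ?thesis using that(2) le_iff \<alpha>_eq by auto
  qed
  then have "\<alpha> \<in> Mor (OI \<iota>) (Std (OI \<iota>) (card S)) X"
    using \<alpha> assms by (auto simp: OI_def X inj_eq)
  moreover have "\<exists>i j. \<beta> x = \<iota> i \<and> \<beta> y = \<iota> j \<and> 1 \<le> i \<and> i \<le> j \<and> j \<le> card S"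
    if "x \<in> S" "y \<in> S" "(x, y) \<in> r" for x y
  proof (intro exI conjI)
    have "p x \<in> {1..card S}" "p y \<in> {1..card S}" using that im by blast+
    then show "1 \<le> p x" "p y \<le> card S" by auto
    show "p x \<le> p y" using that le_iff by simp
  qed (use that \<beta>_eq in auto)
  then have "\<beta> \<in> Mor (OI \<iota>) X (Std (OI \<iota>) (card S))"
    using \<beta> by (simp add: OI_def X)
  ultimately show "\<exists>n. \<exists>\<alpha>\<in>Mor (OI \<iota>) (Std (OI \<iota>) n) X. \<exists>\<beta>\<in>Mor (OI \<iota>) X (Std (OI \<iota>) n).
      compose (Pt (OI \<iota>) X) \<alpha> \<beta> = (\<lambda>x\<in>Pt (OI \<iota>) X. x)"
    using id by (auto simp: OI_def X)
qed

theorem theorem6p15: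
  fixes \<iota> :: "nat \<Rightarrow> 'u" and c :: nat
  assumes "inj \<iota>"
    and "noetherian_ring (type_ring :: 'k::{comm_ring,monoid_mult} ring)"
    and "c \<ge> 1"
  shows
    "(\<forall>M :: ('u set \<times> 'u rel, 'u, (nat \<times> 'u) multiset \<Rightarrow>\<^sub>0 'k, 'm) cat_mod.
        cat_module (type_ring :: 'k ring) (OI \<iota>) (X1_power (OI \<iota>) c) M \<longrightarrow>
        finitely_generated (OI \<iota>) (X1_power (OI \<iota>) c) M \<longrightarrow>
        noetherian_module (OI \<iota>) (X1_power (OI \<iota>) c) M) \<and>
     (\<forall>M :: ('u set, 'u, (nat \<times> 'u) multiset \<Rightarrow>\<^sub>0 'k, 'n) cat_mod.
        cat_module (type_ring :: 'k ring) (FI \<iota>) (X1_power (FI \<iota>) c) M \<longrightarrow>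
        finitely_generated (FI \<iota>) (X1_power (FI \<iota>) c) M \<longrightarrow>
        noetherian_module (FI \<iota>) (X1_power (FI \<iota>) c) M)"
  using finitely_generated_imp_noetherian[OF standard_category_OI[OF assms(1)] assms(2)]
    finitely_generated_imp_noetherian[OF standard_category_FI[OF assms(1)] assms(2)]
  by blast

end
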